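(* If $\alpha\in(0,\infty)\setminus\mathbb{N}$ and $c\ge 1$, then $L_{\alpha,c}(x)=O\big(|x|^{-\lfloor 2\alpha+1\rfloor}\big)$ as $|x|\to\infty$.
   Context: For $c>0$ and $\alpha\in\mathbb{R}\setminus\{0,1,2,\dots\}$, the one-dimensional general multiquadric $\phi_{\alpha,c}(x)=(x^2+c^2)^\alpha$ has generalized Fourier transform $$\widehat{\phi}_{\alpha,c}(\xi)=\frac{2^{1+\alpha}}{\Gamma(-\alpha)}\Big(\frac{c}{|\xi|}\Big)^{\alpha+\frac12}K_{\alpha+\frac12}(c|\xi|),\quad \xi\neq 0,$$ where $K_\nu$ is the modified Bessel function of the second kind. Set $$\widehat{L}_{\alpha,c}(\xi)=\frac{\widehat{\phi}_{\alpha,c}(\xi)}{\sum_{j\in\mathbb{Z}}\widehat{\phi}_{\alpha,c}(\xi+2\pi j)},\quad\xi\in\mathbb{R}$$ (extended by continuity to $\xi\in2\pi\mathbb{Z}$). This is in $L_1(\mathbb{R})$, and the fundamental function is $L_{\alpha,c}(x)=\frac1{2\pi}\int_{\mathbb{R}}\widehat{L}_{\alpha,c}(\xi)e^{ix\xi}d\xi$. *)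

theory Defs
  imports "HOL-Analysis.Analysis" "HOL-Library.Landau_Symbols"
begin

text \<open>
  The modified Bessel function of the second kind of real order, by its integral
  representation on the positive half-line; only arguments \<open>z > 0\<close> are meaningful.
\<close>

definition bessel_K :: "real \<Rightarrow> real \<Rightarrow> real" where
  "bessel_K \<nu> z = (LBINT t:{0..}. exp (- z * cosh t) * cosh (\<nu> * t))"

text \<open>
  The generalized Fourier transform of \<open>x \<mapsto> (x\<^sup>2 + c\<^sup>2) powr \<alpha>\<close>, for \<open>c > 0\<close>, \<open>\<alpha> \<notin> \<nat>\<close>
  and \<open>\<xi> \<noteq> 0\<close>.
\<close>

definition multiquadric_hat :: "real \<Rightarrow> real \<Rightarrow> real \<Rightarrow> real" where
  "multiquadric_hat \<alpha> c \<xi> =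
     2 powr (1 + \<alpha>) / Gamma (- \<alpha>) * (c / \<bar>\<xi>\<bar>) powr (\<alpha> + 1/2) *
     bessel_K (\<alpha> + 1/2) (c * \<bar>\<xi>\<bar>)"

definition fundamental_quotient :: "real \<Rightarrow> real \<Rightarrow> real \<Rightarrow> real" where
  "fundamental_quotient \<alpha> c \<xi> =
     multiquadric_hat \<alpha> c \<xi> / (\<Sum>\<^sub>\<infinity>j::int. multiquadric_hat \<alpha> c (\<xi> + 2 * pi * of_int j))"

text \<open>
  On \<open>2\<pi>\<int>\<close> one of the arguments in the quotient is \<open>0\<close>, where the transform is singular;
  there the value is the limit, that is, the extension by continuity.
\<close>

definition fundamental_hat :: "real \<Rightarrow> real \<Rightarrow> real \<Rightarrow> real" where
  "fundamental_hat \<alpha> c \<xi> =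
     (if \<xi> / (2 * pi) \<in> \<int> then Lim (at \<xi>) (fundamental_quotient \<alpha> c)
      else fundamental_quotient \<alpha> c \<xi>)"

definition fundamental_function :: "real \<Rightarrow> real \<Rightarrow> real \<Rightarrow> complex" where
  "fundamental_function \<alpha> c x =
     1 / (2 * of_real pi) *
     (CLBINT \<xi>. of_real (fundamental_hat \<alpha> c \<xi>) * exp (\<i> * of_real x * of_real \<xi>))"

end

theory Submission
  imports Defs
begin

text \<open>
  Put \<open>\<nu> = \<alpha> + 1/2\<close>, \<open>p = 2\<nu> = 2\<alpha> + 1 > 1\<close>, \<open>g x = \<bar>x\<bar> powr -\<nu> * K\<^sub>\<nu> (c\<bar>x\<bar>)\<close>, and let \<open>w\<close> be the
  distance to \<open>2\<pi>\<int>\<close>. The quotient is \<open>Q = g / P\<close> with \<open>P x = \<Sum>\<^sub>j g (x + 2\<pi>j)\<close>. Everything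
  follows from symbol estimates away from the singularities; neither asymptotic expansions nor
  the exponential decay of \<open>K\<^sub>\<nu>\<close> are needed. The \<open>i\<close>-th derivative of \<open>g\<close> is
  \<open>O(\<bar>x\<bar> powr (-p - i))\<close>, so \<open>P\<close> has derivatives \<open>O(w powr (-p - i))\<close>, and as \<open>P\<close> is at least
  a positive multiple of \<open>w powr -p\<close>, the quotient \<open>Q\<close> has derivatives
  \<open>O(\<bar>x\<bar> powr -p * w powr (p - i))\<close>. Near \<open>0\<close>, where this bound is useless, one writes
  \<open>1 - Q = (P - g) / P\<close>, whose derivatives are \<open>O(w powr (p - i))\<close>. Hence for
  \<open>i < \<lfloor>p\<rfloor>\<close> the derivatives of \<open>Q\<close> extend continuously to \<open>2\<pi>\<int>\<close>, and all derivatives of order at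
  most \<open>\<lfloor>p\<rfloor>\<close> are bounded by a multiple of \<open>\<bar>x\<bar> powr -p\<close> at infinity, hence integrable.
  Integrating by parts \<open>\<lfloor>p\<rfloor>\<close> times gives the decay.
\<close>

subsection \<open>Symbol classes\<close>

text \<open>
  \<open>symbol_on U w n u f\<close>: on \<open>U\<close>, for all \<open>i \<le> n\<close>, the \<open>i\<close>-th derivative of \<open>f\<close> is bounded by a
  constant times \<open>u / w ^ i\<close>. The recursion on \<open>n\<close> makes closure under products and reciprocals
  immediate, without Leibniz or Faa di Bruno formulas.
\<close>

fun symbol_on :: "real set \<Rightarrow> (real \<Rightarrow> real) \<Rightarrow> nat \<Rightarrow> (real \<Rightarrow> real) \<Rightarrow> (real \<Rightarrow> real) \<Rightarrow> bool" where
  "symbol_on U w 0 u f \<longleftrightarrow> (\<exists>C\<ge>0. \<forall>x\<in>U. \<bar>f x\<bar> \<le> C * u x)"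
| "symbol_on U w (Suc n) u f \<longleftrightarrow> (\<exists>C\<ge>0. \<forall>x\<in>U. \<bar>f x\<bar> \<le> C * u x) \<and>
     (\<exists>f'. (\<forall>x\<in>U. (f has_real_derivative f' x) (at x)) \<and> symbol_on U w n (\<lambda>x. u x / w x) f')"

lemma symbol_on_bound: "symbol_on U w n u f \<Longrightarrow> \<exists>C\<ge>0. \<forall>x\<in>U. \<bar>f x\<bar> \<le> C * u x"
  by (cases n) auto

lemma symbol_on_SucI:
  assumes "C \<ge> 0" "\<And>x. x \<in> U \<Longrightarrow> \<bar>f x\<bar> \<le> C * u x"
    and "\<And>x. x \<in> U \<Longrightarrow> (f has_real_derivative f' x) (at x)"
    and "symbol_on U w n (\<lambda>x. u x / w x) f'"
  shows "symbol_on U w (Suc n) u f"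
  using assms by auto

lemma symbol_on_Suc_lower: "symbol_on U w (Suc n) u f \<Longrightarrow> symbol_on U w n u f"
proof (induction n arbitrary: u f)
  case 0
  then show ?case by simp
next
  case (Suc n)
  from Suc.prems obtain C f' where f': "C \<ge> 0" "\<And>x. x \<in> U \<Longrightarrow> \<bar>f x\<bar> \<le> C * u x"
    "\<And>x. x \<in> U \<Longrightarrow> (f has_real_derivative f' x) (at x)" "symbol_on U w (Suc n) (\<lambda>x. u x / w x) f'"
    unfolding symbol_on.simps(2)[of U w "Suc n"] by blast
  show ?case by (rule symbol_on_SucI[OF f'(1-3) Suc.IH[OF f'(4)]])
qed

text \<open>Serves to restrict the domain and to trade the scale |x| for the smaller
  \<open>lattice_dist\<close>. A smaller scale only enlarges the allowed size
  \<open>u / w ^ i\<close>, as \<open>u\<close> is nonnegative, and the factor \<open>K\<close>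
  between the weights passes unchanged through every order.\<close>

lemma symbol_on_mono:
  assumes "symbol_on U w n u f" "V \<subseteq> U" "K \<ge> 0"
    and "\<And>x. x \<in> V \<Longrightarrow> u x \<le> K * v x"
    and "\<And>x. x \<in> V \<Longrightarrow> 0 \<le> u x"
    and "\<And>x. x \<in> V \<Longrightarrow> 0 < w' x \<and> w' x \<le> w x"
  shows "symbol_on V w' n v f"
proof -
  have bd: "\<exists>C\<ge>0. \<forall>x\<in>V. \<bar>f x\<bar> \<le> C * v x"
    if f: "\<exists>C\<ge>0. \<forall>x\<in>U. \<bar>f x\<bar> \<le> C * u x" and u: "\<And>x. x \<in> V \<Longrightarrow> u x \<le> K * v x" for f u v
  proof -
    obtain C where C: "C \<ge> 0" "\<forall>x\<in>U. \<bar>f x\<bar> \<le> C * u x" using f by auto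
    have "\<bar>f x\<bar> \<le> (C * K) * v x" if "x \<in> V" for x
      using C(2) that \<open>V \<subseteq> U\<close> mult_left_mono[OF u[OF that] C(1)]
      by (force simp: mult.assoc)
    then show ?thesis using C(1) \<open>K \<ge> 0\<close> by (intro exI[of _ "C * K"]) auto
  qed
  show ?thesis
    using assms(1,4,5)
  proof (induction n arbitrary: u v f)
    case 0
    then show ?case using bd[of f u v] by simp
  next
    case (Suc n)
    from Suc.prems(1) obtain f' where f': "\<forall>x\<in>U. (f has_real_derivative f' x) (at x)"
      "symbol_on U w n (\<lambda>x. u x / w x) f'" and f: "\<exists>C\<ge>0. \<forall>x\<in>U. \<bar>f x\<bar> \<le> C * u x" by auto
    have "symbol_on V w' n (\<lambda>x. v x / w' x) f'"
    proof (rule Suc.IH[OF f'(2)])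
      fix x assume x: "x \<in> V"
      have w: "0 < w' x" "w' x \<le> w x" using assms(6)[OF x] by auto
      show "0 \<le> u x / w x" using w Suc.prems(3)[OF x] by auto
      have "u x / w x \<le> u x / w' x"
        using w Suc.prems(3)[OF x] by (simp add: frac_le)
      also have "\<dots> \<le> K * v x / w' x" using Suc.prems(2)[OF x] w by (simp add: divide_right_mono)
      finally show "u x / w x \<le> K * (v x / w' x)" by simp
    qed
    with bd[OF f Suc.prems(2)] f'(1) assms(2) show ?case by auto
  qed
qed

lemma symbol_on_cong_weight:
  assumes "symbol_on U w n u f" "\<And>x. x \<in> U \<Longrightarrow> u x = v x"
    and "\<And>x. x \<in> U \<Longrightarrow> 0 \<le> u x" "\<And>x. x \<in> U \<Longrightarrow> 0 < w x"
  shows "symbol_on U w n v f"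
  by (rule symbol_on_mono[OF assms(1), where K = 1]) (use assms(2-) in auto)

lemma symbol_on_const:
  assumes "\<And>x. x \<in> U \<Longrightarrow> 0 \<le> u x" "\<And>x. x \<in> U \<Longrightarrow> 0 < w x" "K \<ge> 0" "\<And>x. x \<in> U \<Longrightarrow> \<bar>c\<bar> \<le> K * u x"
  shows "symbol_on U w n u (\<lambda>_. c)"
  using assms
proof (induction n arbitrary: c u K)
  case (Suc n)
  have "symbol_on U w n (\<lambda>x. u x / w x) (\<lambda>x. 0)"
  proof (rule Suc.IH[where K = 0])
    fix x assume "x \<in> U"
    then show "0 \<le> u x / w x" using Suc.prems(1,2)[of x] by simp
  qed (use Suc.prems in auto)
  then show ?case using Suc.prems
    by (intro symbol_on_SucI[where f' = "\<lambda>_. 0" and C = K]) (auto intro!: derivative_eq_intros)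
qed auto

lemma symbol_on_add:
  assumes "symbol_on U w n u f" "symbol_on U w n u g"
  shows "symbol_on U w n u (\<lambda>x. f x + g x)"
  using assms
proof (induction n arbitrary: u f g)
  case 0
  then obtain C D where "C \<ge> 0" "D \<ge> 0" "\<forall>x\<in>U. \<bar>f x\<bar> \<le> C * u x" "\<forall>x\<in>U. \<bar>g x\<bar> \<le> D * u x" by auto
  then show ?case
    by (auto intro!: exI[of _ "C + D"] order_trans[OF abs_triangle_ineq] add_mono simp: distrib_right)
next
  case (Suc n)
  from Suc.prems(1) obtain f' where f': "\<forall>x\<in>U. (f has_real_derivative f' x) (at x)"
    "symbol_on U w n (\<lambda>x. u x / w x) f'" by auto
  from Suc.prems(2) obtain g' where g': "\<forall>x\<in>U. (g has_real_derivative g' x) (at x)"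
    "symbol_on U w n (\<lambda>x. u x / w x) g'" by auto
  obtain C D where "C \<ge> 0" "D \<ge> 0" "\<forall>x\<in>U. \<bar>f x\<bar> \<le> C * u x" "\<forall>x\<in>U. \<bar>g x\<bar> \<le> D * u x"
    using Suc.prems by auto
  then show ?case
    by (intro symbol_on_SucI[where C = "C + D" and f' = "\<lambda>x. f' x + g' x"] Suc.IH f' g')
       (use f' g' in \<open>auto simp: distrib_right intro!: derivative_intros order_trans[OF abs_triangle_ineq] add_mono\<close>)
qed

text \<open>Both summands of (f g)' = f' g + f g' carry the weight \<open>u * v / w\<close>. The
  induction hypothesis is used once with the weights \<open>u / w\<close> and \<open>v\<close>, once
  with \<open>u\<close> and \<open>v / w\<close>, so the weights must vary in the induction.\<close>

lemma symbol_on_mult: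
  assumes "symbol_on U w n u f" "symbol_on U w n v g"
    and "\<And>x. x \<in> U \<Longrightarrow> 0 \<le> u x" "\<And>x. x \<in> U \<Longrightarrow> 0 \<le> v x" "\<And>x. x \<in> U \<Longrightarrow> 0 < w x"
  shows "symbol_on U w n (\<lambda>x. u x * v x) (\<lambda>x. f x * g x)"
proof -
  have bd: "\<exists>C\<ge>0. \<forall>x\<in>U. \<bar>f x * g x\<bar> \<le> C * (u x * v x)"
    if "\<exists>C\<ge>0. \<forall>x\<in>U. \<bar>f x\<bar> \<le> C * u x" "\<exists>C\<ge>0. \<forall>x\<in>U. \<bar>g x\<bar> \<le> C * v x" for f g u v :: "real \<Rightarrow> real"
  proof -
    obtain C D where CD: "C \<ge> 0" "D \<ge> 0" "\<forall>x\<in>U. \<bar>f x\<bar> \<le> C * u x" "\<forall>x\<in>U. \<bar>g x\<bar> \<le> D * v x"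
      using \<open>\<exists>C\<ge>0. \<forall>x\<in>U. \<bar>f x\<bar> \<le> C * u x\<close> \<open>\<exists>C\<ge>0. \<forall>x\<in>U. \<bar>g x\<bar> \<le> C * v x\<close> by auto
    have "\<bar>f x * g x\<bar> \<le> (C * D) * (u x * v x)" if "x \<in> U" for x
    proof -
      have "\<bar>f x\<bar> * \<bar>g x\<bar> \<le> (C * u x) * (D * v x)"
        using CD that by (intro mult_mono) (auto intro: order_trans[OF abs_ge_zero])
      then show ?thesis by (simp add: abs_mult algebra_simps)
    qed
    then show ?thesis using CD by (intro exI[of _ "C * D"]) auto
  qed
  show ?thesis using assms(1-4)
  proof (induction n arbitrary: u v f g)
    case 0
    then show ?case using bd by simp
  next
    case (Suc n)
    from Suc.prems(1) obtain f' where f': "\<forall>x\<in>U. (f has_real_derivative f' x) (at x)"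
      "symbol_on U w n (\<lambda>x. u x / w x) f'" by auto
    from Suc.prems(2) obtain g' where g': "\<forall>x\<in>U. (g has_real_derivative g' x) (at x)"
      "symbol_on U w n (\<lambda>x. v x / w x) g'" by auto
    have u: "0 \<le> u x / w x" and v: "0 \<le> v x / w x" if "x \<in> U" for x
      using that Suc.prems(3,4)[of x] assms(5)[of x] by auto
    have "symbol_on U w n (\<lambda>x. u x * v x / w x) (\<lambda>x. f' x * g x)"
      by (rule symbol_on_cong_weight[OF Suc.IH[OF f'(2) symbol_on_Suc_lower[OF Suc.prems(2)] u Suc.prems(4)]])
        (use Suc.prems(3,4) assms(5) in \<open>auto simp: less_imp_le\<close>)
    moreover have "symbol_on U w n (\<lambda>x. u x * v x / w x) (\<lambda>x. f x * g' x)"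
      by (rule symbol_on_cong_weight[OF Suc.IH[OF symbol_on_Suc_lower[OF Suc.prems(1)] g'(2) Suc.prems(3) v]])
        (use Suc.prems(3,4) assms(5) in \<open>auto simp: less_imp_le\<close>)
    ultimately have *: "symbol_on U w n (\<lambda>x. u x * v x / w x) (\<lambda>x. f' x * g x + f x * g' x)"
      by (rule symbol_on_add)
    obtain C where "C \<ge> 0" "\<forall>x\<in>U. \<bar>f x * g x\<bar> \<le> C * (u x * v x)"
      using bd[of f u g v] Suc.prems(1,2) by auto
    then show ?case
      by (intro symbol_on_SucI[OF _ _ _ *]) (use f' g' in \<open>auto intro!: derivative_eq_intros\<close>)
  qed
qed

text \<open>Since (1/f)' = - f' (1/f)^2, the bounds of order \<open>n\<close> for 1/f, combined by
  the product rule, give those of order \<open>n + 1\<close>. The weights match because (u/w)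
  (1/u)^2 = (1/u)/w.\<close>

lemma symbol_on_inverse:
  assumes "symbol_on U w n u f" "c > 0"
    and "\<And>x. x \<in> U \<Longrightarrow> c * u x \<le> \<bar>f x\<bar>" "\<And>x. x \<in> U \<Longrightarrow> 0 < u x" "\<And>x. x \<in> U \<Longrightarrow> 0 < w x"
  shows "symbol_on U w n (\<lambda>x. 1 / u x) (\<lambda>x. 1 / f x)"
proof -
  have bd: "\<bar>1 / f x\<bar> \<le> 1 / c * (1 / u x)" if "x \<in> U" for x
  proof -
    have "0 < c * u x" using assms(2) assms(4)[OF that] by simp
    then have "1 / \<bar>f x\<bar> \<le> 1 / (c * u x)"
      using assms(3)[OF that] by (simp add: frac_le)
    then show ?thesis by simp
  qed
  have f0: "f x \<noteq> 0" if "x \<in> U" for x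
    using assms(3,4)[OF that] mult_pos_pos[OF assms(2), of "u x"] by auto
  show ?thesis using assms(1)
  proof (induction n)
    case 0
    then show ?case using bd assms(2) by (auto intro!: exI[of _ "1 / c"])
  next
    case (Suc n)
    from Suc.prems(1) obtain f' where f': "\<forall>x\<in>U. (f has_real_derivative f' x) (at x)"
      "symbol_on U w n (\<lambda>x. u x / w x) f'" by auto
    have pos: "0 \<le> u x" "0 < w x" "0 < u x" if "x \<in> U" for x
      using assms(4,5)[OF that] by auto
    \<comment> \<open>The induction hypothesis for 1/f itself; it enters twice in the
      derivative.\<close>
    have inv: "symbol_on U w n (\<lambda>x. 1 / u x) (\<lambda>x. 1 / f x)"
      by (rule Suc.IH[OF symbol_on_Suc_lower[OF Suc.prems]])
    have 1: "symbol_on U w n (\<lambda>x. (u x / w x) * (1 / u x * (1 / u x))) (\<lambda>x. f' x * (1 / f x * (1 / f x)))"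
      by (intro symbol_on_mult f' inv) (use pos in \<open>auto simp: less_imp_le\<close>)
    have 2: "symbol_on U w n (\<lambda>_. 1) (\<lambda>_. -1)"
      by (rule symbol_on_const[where K = 1]) (use pos in auto)
    have *: "symbol_on U w n (\<lambda>x. 1 * ((u x / w x) * (1 / u x * (1 / u x))))
        (\<lambda>x. - 1 * (f' x * (1 / f x * (1 / f x))))"
      by (rule symbol_on_mult[OF 2 1]) (use pos in \<open>auto simp: less_imp_le\<close>)
    have "symbol_on U w n (\<lambda>x. 1 / u x / w x) (\<lambda>x. - 1 * (f' x * (1 / f x * (1 / f x))))"
      by (rule symbol_on_cong_weight[OF *]) (use pos in \<open>auto simp: less_imp_le less_imp_neq[symmetric]\<close>)
    then show ?case
      by (rule symbol_on_SucI[of "1 / c", rotated 3])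
        (use bd f' f0 assms(2) in \<open>auto intro!: derivative_eq_intros simp: power2_eq_square\<close>)
  qed
qed

lemma symbol_on_cong:
  assumes "symbol_on U w n u f" "open U" "\<And>x. x \<in> U \<Longrightarrow> f x = g x"
  shows "symbol_on U w n u g"
proof (cases n)
  case 0
  then show ?thesis using assms by auto
next
  case (Suc m)
  with assms(1) obtain f' where f': "\<forall>x\<in>U. (f has_real_derivative f' x) (at x)"
      "symbol_on U w m (\<lambda>x. u x / w x) f'" by auto
  have "(g has_real_derivative f' x) (at x)" if "x \<in> U" for x
    by (rule has_field_derivative_transform_within_open[OF _ assms(2) that assms(3)]) (use f' that in auto)
  with f' assms Suc show ?thesis by auto
qed

text \<open>Unrolls the nested existential quantifiers of \<open>symbol_on\<close> into one sequence
  of derivatives, the form that termwise differentiation and repeated integration by parts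
  require.\<close>

lemma symbol_on_derivatives:
  assumes "symbol_on U w n u f" "\<And>x. x \<in> U \<Longrightarrow> 0 < w x"
  shows "\<exists>F. F 0 = f \<and> (\<forall>i<n. \<forall>x\<in>U. (F i has_real_derivative F (Suc i) x) (at x)) \<and>
    (\<forall>i\<le>n. \<exists>C\<ge>0. \<forall>x\<in>U. \<bar>F i x\<bar> \<le> C * (u x / w x ^ i))"
  using assms(1)
proof (induction n arbitrary: u f)
  case 0
  then show ?case by (auto intro!: exI[of _ "\<lambda>_. f"])
next
  case (Suc n)
  from Suc.prems(1) obtain f' where f': "\<forall>x\<in>U. (f has_real_derivative f' x) (at x)"
      "symbol_on U w n (\<lambda>x. u x / w x) f'" by auto
  from Suc.IH[OF f'(2)] obtain F where F: "F 0 = f'"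
    "\<forall>i<n. \<forall>x\<in>U. (F i has_real_derivative F (Suc i) x) (at x)"
    "\<forall>i\<le>n. \<exists>C\<ge>0. \<forall>x\<in>U. \<bar>F i x\<bar> \<le> C * (u x / w x / w x ^ i)" by auto
  define G where "G = (\<lambda>i. case i of 0 \<Rightarrow> f | Suc j \<Rightarrow> F j)"
  have "\<exists>C\<ge>0. \<forall>x\<in>U. \<bar>G i x\<bar> \<le> C * (u x / w x ^ i)" if "i \<le> Suc n" for i
    using F(3) Suc.prems that by (cases i) (auto simp: G_def)
  moreover have "(G i has_real_derivative G (Suc i) x) (at x)" if "i < Suc n" "x \<in> U" for i x
    using F(1,2) f'(1) that by (cases i) (auto simp: G_def)
  ultimately show ?case by (intro exI[of _ G]) (auto simp: G_def)
qed

section \<open>Differentiation under the integral sign\<close>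

text \<open>Dominated convergence for difference quotients along sequences tending to
  \<open>x\<close>; by the mean value inequality on the ball, each quotient is bounded by
  \<open>B\<close>.\<close>

lemma has_real_derivative_integral:
  fixes f f' :: "real \<Rightarrow> 'a \<Rightarrow> real"
  assumes "d > 0"
    and int: "\<And>y. y \<in> ball x d \<Longrightarrow> integrable M (f y)"
    and der: "\<And>y t. y \<in> ball x d \<Longrightarrow> t \<in> space M \<Longrightarrow> ((\<lambda>y. f y t) has_real_derivative f' y t) (at y)"
    and bd: "\<And>y t. y \<in> ball x d \<Longrightarrow> t \<in> space M \<Longrightarrow> \<bar>f' y t\<bar> \<le> B t"
    and B: "integrable M B" and meas: "f' x \<in> borel_measurable M"
  shows "((\<lambda>y. \<integral>t. f y t \<partial>M) has_real_derivative (\<integral>t. f' x t \<partial>M)) (at x)"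
proof -
  \<comment> \<open>The limit is taken within the ball, so that every term of a test sequence lies
    where the bound holds; openness of the ball removes the restriction at the end.\<close>
  have "((\<lambda>y. ((\<integral>t. f y t \<partial>M) - (\<integral>t. f x t \<partial>M)) / (y - x)) \<longlongrightarrow> (\<integral>t. f' x t \<partial>M)) (at x within ball x d)"
    unfolding tendsto_at_iff_sequentially
  proof (intro allI impI)
    fix X :: "nat \<Rightarrow> real"
    assume X: "\<forall>i. X i \<in> ball x d - {x}" "X \<longlonglongrightarrow> x"
    have x: "x \<in> ball x d" using \<open>d > 0\<close> by simp
    have lim: "filterlim X (at x) sequentially"
      using X by (auto simp: filterlim_at)
    define q where "q i t = (f (X i) t - f x t) / (X i - x)" for i t
    have "(\<lambda>i. \<integral>t. q i t \<partial>M) \<longlonglongrightarrow> (\<integral>t. f' x t \<partial>M)"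
    proof (rule integral_dominated_convergence[OF meas _ B])
      show "q i \<in> borel_measurable M" for i
        unfolding q_def using int[OF x] int[of "X i"] X by auto
      show "AE t in M. (\<lambda>i. q i t) \<longlonglongrightarrow> f' x t"
      proof (rule AE_I2)
        fix t assume t: "t \<in> space M"
        show "(\<lambda>i. q i t) \<longlonglongrightarrow> f' x t"
          using filterlim_compose[OF der[OF x t, unfolded has_field_derivative_iff] lim]
          by (simp add: q_def)
      qed
      show "AE t in M. norm (q i t) \<le> B t" for i
      proof (rule AE_I2)
        fix t assume t: "t \<in> space M"
        have Xi: "X i \<in> ball x d" "X i \<noteq> x" using X by auto
        have "norm (f (X i) t - f x t) \<le> B t * norm (X i - x)"
          by (rule field_differentiable_bound[of "ball x d" _ "\<lambda>y. f' y t"])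
             (use x Xi t der bd in \<open>auto intro: has_field_derivative_at_within\<close>)
        then show "norm (q i t) \<le> B t"
          using Xi by (simp add: q_def field_simps)
      qed
    qed
    moreover have "(\<integral>t. q i t \<partial>M) = ((\<integral>t. f (X i) t \<partial>M) - (\<integral>t. f x t \<partial>M)) / (X i - x)" for i
      unfolding q_def using int[OF x] int[of "X i"] X by simp
    ultimately show "((\<lambda>y. ((\<integral>t. f y t \<partial>M) - (\<integral>t. f x t \<partial>M)) / (y - x)) \<circ> X) \<longlonglongrightarrow> (\<integral>t. f' x t \<partial>M)"
      by (simp add: o_def)
  qed
  then show ?thesis
    using at_within_open[of x "ball x d"] \<open>d > 0\<close> by (simp add: has_field_derivative_iff)
qed

text \<open>The measure is left general so that one lemma serves both the integral of the Bessel
  function and, with a counting measure, termwise differentiation of lattice sums.\<close>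

lemma symbol_on_integral:
  fixes f :: "nat \<Rightarrow> real \<Rightarrow> 'a \<Rightarrow> real"
  assumes int: "\<And>i x. x \<in> U \<Longrightarrow> i \<le> n \<Longrightarrow> integrable M (f i x)"
    and der: "\<And>i x t. x \<in> U \<Longrightarrow> t \<in> space M \<Longrightarrow> i < n \<Longrightarrow> ((\<lambda>x. f i x t) has_real_derivative f (Suc i) x t) (at x)"
    and dom: "\<And>i x. x \<in> U \<Longrightarrow> i < n \<Longrightarrow> \<exists>d>0. \<exists>B. ball x d \<subseteq> U \<and> integrable M B \<and>
        (\<forall>y\<in>ball x d. \<forall>t\<in>space M. \<bar>f (Suc i) y t\<bar> \<le> B t)"
    and bd: "\<And>i. i \<le> n \<Longrightarrow> \<exists>C\<ge>0. \<forall>x\<in>U. \<bar>\<integral>t. f i x t \<partial>M\<bar> \<le> C * (u x / w x ^ i)"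
  shows "symbol_on U w n u (\<lambda>x. \<integral>t. f 0 x t \<partial>M)"
proof -
  \<comment> \<open>Generalised to start at the i-th derivative with \<open>m\<close> orders left,
    because each step of the recursion moves on to the integral of the next derivative.\<close>
  have "symbol_on U w m (\<lambda>x. u x / w x ^ i) (\<lambda>x. \<integral>t. f i x t \<partial>M)" if "i + m \<le> n" for i m
    using that
  proof (induction m arbitrary: i)
    case 0
    then show ?case using bd[of i] by simp
  next
    case (Suc m)
    have 1: "((\<lambda>x. \<integral>t. f i x t \<partial>M) has_real_derivative (\<integral>t. f (Suc i) x t \<partial>M)) (at x)" if x: "x \<in> U" for x
    proof -
      obtain d B where dB: "d > 0" "ball x d \<subseteq> U" "integrable M B"
        "\<forall>y\<in>ball x d. \<forall>t\<in>space M. \<bar>f (Suc i) y t\<bar> \<le> B t" using dom[OF x, of i] Suc.prems by auto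
      show ?thesis
      proof (rule has_real_derivative_integral[OF dB(1) _ _ _ dB(3)])
        show "f (Suc i) x \<in> borel_measurable M" using int[OF x] Suc.prems by auto
        show "((\<lambda>y. f i y t) has_real_derivative f (Suc i) y t) (at y)"
          if "y \<in> ball x d" "t \<in> space M" for y t
          using der[of y t i] that dB(2) Suc.prems by auto
        show "integrable M (f i y)" if "y \<in> ball x d" for y
          using int[of y i] that dB(2) Suc.prems by auto
      qed (use dB(4) in blast)
    qed
    have 2: "symbol_on U w m (\<lambda>x. u x / w x ^ i / w x) (\<lambda>x. \<integral>t. f (Suc i) x t \<partial>M)"
      using Suc.IH[of "Suc i"] Suc.prems by (simp add: mult.commute)
    obtain C where "C \<ge> 0" "\<forall>x\<in>U. \<bar>\<integral>t. f i x t \<partial>M\<bar> \<le> C * (u x / w x ^ i)" using bd[of i] Suc.prems by auto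
    then show ?case
      by (intro symbol_on_SucI[OF _ _ 1 2]) auto
  qed
  from this[of 0 n] show ?thesis by simp
qed

subsection \<open>Bessel functions and the radial transform\<close>

lemma integrable_max_powr:
  fixes p :: real
  assumes "p > 1"
  shows "integrable lborel (\<lambda>x. max 1 \<bar>x\<bar> powr - p)"
proof -
  define f where "f = (\<lambda>x::real. if x \<in> {1..} then x powr - p else 0)"
  have f0: "f x \<ge> 0" for x by (simp add: f_def)
  have meas: "f \<in> borel_measurable borel" unfolding f_def by measurable
  have "((\<lambda>x. x powr - p) has_integral -(1 powr (- p + 1)) / (- p + 1)) {1..}"
    using has_integral_powr_to_inf[of "- p" 1] assms by simp
  then have "(f has_integral -(1 powr (- p + 1)) / (- p + 1)) UNIV"
    unfolding f_def by (subst has_integral_restrict_UNIV)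
  then have "integral\<^sup>N lborel f = ennreal (-(1 powr (- p + 1)) / (- p + 1))"
    using meas f0 by (intro nn_integral_has_integral_lborel) auto
  then have f: "integrable lborel f"
    using meas f0 by (intro integrableI_bounded) auto
  then have f': "integrable lborel (\<lambda>x. f (- x))"
    using lborel_integrable_real_affine[OF f, of "-1" 0] by simp
  have i: "integrable lborel (indicator {-1..1::real} :: real \<Rightarrow> real)"
    by simp
  \<comment> \<open>Two tails, one for each half-line, and the indicator of the middle interval
    together dominate the function.\<close>
  have "integrable lborel (\<lambda>x. f x + f (- x) + indicator {-1..1} x)"
    using f f' i by auto
  then show ?thesis
    by (rule Bochner_Integration.integrable_bound)
      (auto simp: f_def indicator_def max_def abs_if)
qed

text \<open>Under u = exp s this is the Gamma integral of u^(p-1) exp(-u). Integrability is shown by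
  bounding the exponent by a constant minus \<open>a * \<bar>s\<bar>\<close>.\<close>

lemma integrable_exp_exp:
  fixes p :: real
  assumes "p > 0"
  shows "integrable lborel (\<lambda>s. exp (p * s - exp s))"
proof -
  define a where "a = p / 2"
  have a: "a > 0" using assms by (simp add: a_def)
  \<comment> \<open>The graph of exp lies above its tangent of slope \<open>q\<close>, which touches
    it at ln q.\<close>
  have tangent: "exp s \<ge> q * (1 + s - ln q)" if "q > 0" for q s :: real
  proof -
    have "exp (s - ln q) \<ge> 1 + (s - ln q)" by (rule exp_ge_add_one_self)
    then have "exp s / q \<ge> 1 + (s - ln q)" using that by (simp add: exp_diff)
    then show ?thesis using that by (simp add: field_simps)
  qed
  \<comment> \<open>As p = 2a, the tangent of slope \<open>a\<close> leaves a s for negative s, and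
    the tangent of slope 3a leaves -a s for positive s. The two entries of the maximum are the
    resulting constants.\<close>
  define C where "C = max (a * (ln a - 1)) (3 * a * (ln (3 * a) - 1))"
  have C: "p * s - exp s \<le> C - a * \<bar>s\<bar>" for s
  proof (cases "s \<le> 0")
    case True
    have "a * (ln a - 1) \<le> C" by (simp add: C_def)
    then show ?thesis using tangent[OF a, of s] True by (simp add: a_def algebra_simps)
  next
    case False
    have "3 * a * (ln (3 * a) - 1) \<le> C" by (simp add: C_def)
    then show ?thesis using tangent[of "3 * a" s] a False by (simp add: a_def algebra_simps)
  qed
  \<comment> \<open>Exponential decay is weakened to the power -2 through t^2/2 \<le> exp t; the
    summand 1 in the constant covers \<bar>s\<bar> \<le> 1.\<close>
  have E: "exp (- a * \<bar>s\<bar>) \<le> (1 + 2 / a\<^sup>2) * max 1 \<bar>s\<bar> powr - 2" for s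
  proof (cases "\<bar>s\<bar> \<le> 1")
    case True
    have "exp (- a * \<bar>s\<bar>) \<le> 1" using a by simp
    also have "1 \<le> 1 + 2 / a\<^sup>2" by simp
    finally have "exp (- a * \<bar>s\<bar>) \<le> 1 + 2 / a\<^sup>2" .
    moreover have "max 1 \<bar>s\<bar> = 1" using True by simp
    ultimately show ?thesis by (simp only: powr_one_eq_one mult_1_right)
  next
    case False
    have "(a * \<bar>s\<bar>)\<^sup>2 / 2 \<le> exp (a * \<bar>s\<bar>)"
      using exp_lower_Taylor_quadratic[of "a * \<bar>s\<bar>"] a by (smt (verit) abs_ge_zero mult_nonneg_nonneg)
    moreover have "(a * \<bar>s\<bar>)\<^sup>2 / 2 > 0" using a False by auto
    ultimately have "1 / exp (a * \<bar>s\<bar>) \<le> 1 / ((a * \<bar>s\<bar>)\<^sup>2 / 2)"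
      by (intro divide_left_mono) auto
    then have "exp (- a * \<bar>s\<bar>) \<le> 2 / a\<^sup>2 * (1 / s\<^sup>2)"
      by (simp add: exp_minus field_simps)
    also have "\<dots> \<le> (1 + 2 / a\<^sup>2) * (1 / s\<^sup>2)" by (intro mult_right_mono) auto
    also have "1 / s\<^sup>2 = max 1 \<bar>s\<bar> powr - 2"
      using False by (simp add: max_def powr_minus powr_numeral divide_inverse)
    finally show ?thesis .
  qed
  have *: "integrable lborel (\<lambda>s. exp C * ((1 + 2 / a\<^sup>2) * max 1 \<bar>s\<bar> powr - 2))"
    by (intro integrable_mult_right integrable_max_powr) auto
  show ?thesis
  proof (rule Bochner_Integration.integrable_bound[OF *])
    show "AE s in lborel. norm (exp (p * s - exp s)) \<le> norm (exp C * ((1 + 2 / a\<^sup>2) * max 1 \<bar>s\<bar> powr - 2))"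
    proof (rule AE_I2)
      fix s :: real
      have "exp (p * s - exp s) \<le> exp C * exp (- a * \<bar>s\<bar>)"
        using C[of s] by (simp flip: exp_add)
      also have "\<dots> \<le> exp C * ((1 + 2 / a\<^sup>2) * max 1 \<bar>s\<bar> powr - 2)"
        using E[of s] by (intro mult_left_mono) auto
      finally show "norm (exp (p * s - exp s)) \<le> norm (exp C * ((1 + 2 / a\<^sup>2) * max 1 \<bar>s\<bar> powr - 2))"
        by simp
    qed
  qed auto
qed

text \<open>Translation by ln a absorbs the factor \<open>a\<close>. The shape
  \<open>ln a + 1 * t\<close> is that of the affine substitution rules for
  \<open>lborel\<close>.\<close>

lemma exp_exp_scale:
  fixes a p :: real
  assumes "a > 0"
  shows "exp (p * t - a * exp t) = a powr - p * exp (p * (ln a + 1 * t) - exp (ln a + 1 * t))"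
  using assms by (simp add: powr_def exp_add algebra_simps flip: exp_diff) (simp add: exp_diff exp_minus field_simps exp_add)

lemma
  fixes a p :: real
  assumes "a > 0" "p > 0"
  shows integrable_exp_exp_scale: "integrable lborel (\<lambda>t. exp (p * t - a * exp t))"
    and integral_exp_exp_scale:
      "(\<integral>t. exp (p * t - a * exp t) \<partial>lborel) = a powr - p * (\<integral>t. exp (p * t - exp t) \<partial>lborel)"
  using lborel_integrable_real_affine[OF integrable_exp_exp[OF assms(2)], of 1 "ln a"]
    lborel_integral_real_affine[of 1 "\<lambda>t. exp (p * t - exp t)" "ln a"]
  by (simp_all only: exp_exp_scale[OF assms(1)]) auto

section \<open>Upper and lower bounds for the Bessel function\<close>

text \<open>The i-th x-derivative of the integrand of K_\<nu>(c x): each differentiation brings down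
  a factor -c cosh t. The indicator turns integrals over the half-line into integrals over
  \<open>lborel\<close>.\<close>

definition bessel_integrand :: "real \<Rightarrow> real \<Rightarrow> nat \<Rightarrow> real \<Rightarrow> real \<Rightarrow> real" where
  "bessel_integrand \<nu> c i x t =
     indicator {0..} t * ((- (c * cosh t)) ^ i * exp (- (c * x) * cosh t) * cosh (\<nu> * t))"

lemma bessel_integrand_measurable [measurable]: "bessel_integrand \<nu> c i x \<in> borel_measurable borel"
proof -
  have "cosh \<in> borel_measurable (borel :: real measure)"
    by (intro borel_measurable_continuous_onI continuous_intros)
  then show ?thesis unfolding bessel_integrand_def[abs_def] by measurable
qed

text \<open>Rests on exp(t)/2 \<le> cosh t \<le> exp t for t \<ge> 0. The right-hand side contains
  \<open>y\<close> instead of \<open>x\<close>, so one majorant serves all x \<ge> y; y = x gives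
  integrability and the size of the integral.\<close>

lemma bessel_integrand_bound:
  assumes "c > 0" "\<nu> \<ge> 0" "0 < y" "y \<le> x"
  shows "\<bar>bessel_integrand \<nu> c i x t\<bar> \<le> c ^ i * exp ((\<nu> + real i) * t - (c * y / 2) * exp t)"
proof (cases "t \<ge> 0")
  case True
  have ch: "cosh s \<le> exp s" if "s \<ge> 0" for s :: real
    using that by (simp add: cosh_def)
  have ch2: "exp t / 2 \<le> cosh t" by (simp add: cosh_def)
  have "cosh t \<ge> 0" by (simp add: cosh_def)
  have "\<bar>bessel_integrand \<nu> c i x t\<bar> = (c * cosh t) ^ i * exp (- (c * x) * cosh t) * cosh (\<nu> * t)"
    using True assms \<open>cosh t \<ge> 0\<close> by (simp add: bessel_integrand_def abs_mult power_abs)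
  also have "\<dots> \<le> (c * exp t) ^ i * exp (- (c * y / 2) * exp t) * exp (\<nu> * t)"
  proof (intro mult_mono power_mono)
    have "(c * y) * (exp t / 2) \<le> (c * x) * cosh t"
      using assms ch2 by (intro mult_mono) auto
    then show "exp (- (c * x) * cosh t) \<le> exp (- (c * y / 2) * exp t)" by simp
    show "cosh (\<nu> * t) \<le> exp (\<nu> * t)" using True assms by (intro ch) auto
  qed (use assms True ch in \<open>auto simp: less_imp_le\<close>)
  also have "\<dots> = c ^ i * exp ((\<nu> + real i) * t - (c * y / 2) * exp t)"
  proof -
    have "(c * exp t) ^ i = c ^ i * exp (real i * t)"
      by (simp add: power_mult_distrib exp_of_nat_mult)
    moreover have "(\<nu> + real i) * t - (c * y / 2) * exp t = real i * t + (- (c * y / 2) * exp t + \<nu> * t)"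
      by (simp add: algebra_simps)
    ultimately show ?thesis by (simp only: exp_add mult.assoc)
  qed
  finally show ?thesis .
qed (use assms in \<open>simp add: bessel_integrand_def\<close>)

lemma bessel_integrand_integrable:
  assumes "c > 0" "\<nu> > 0" "0 < x"
  shows "integrable lborel (bessel_integrand \<nu> c i x)"
proof (rule Bochner_Integration.integrable_bound)
  show "integrable lborel (\<lambda>t. c ^ i * exp ((\<nu> + real i) * t - (c * x / 2) * exp t))"
    using assms by (intro integrable_mult_right integrable_exp_exp_scale) auto
  show "AE t in lborel. norm (bessel_integrand \<nu> c i x t)
      \<le> norm (c ^ i * exp ((\<nu> + real i) * t - (c * x / 2) * exp t))"
    using bessel_integrand_bound[of c \<nu> x x i] assms by (auto simp: abs_mult power_abs)
qed auto

lemma bessel_K_eq: "bessel_K \<nu> (c * x) = (\<integral>t. bessel_integrand \<nu> c 0 x t \<partial>lborel)"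
  by (simp add: bessel_K_def set_lebesgue_integral_def bessel_integrand_def)

text \<open>The integrated majorant scales like (c x / 2)^(-\<nu> - i), which is exactly the weight
  x^(-\<nu>) divided by x^i.\<close>

lemma symbol_on_bessel_K:
  assumes "c > 0" "\<nu> > 0"
  shows "symbol_on {0<..} (\<lambda>x. x) n (\<lambda>x. x powr - \<nu>) (\<lambda>x. bessel_K \<nu> (c * x))"
  unfolding bessel_K_eq
proof (rule symbol_on_integral)
  fix i and x t :: real assume x: "x \<in> {0<..}"
  show "((\<lambda>x. bessel_integrand \<nu> c i x t) has_real_derivative bessel_integrand \<nu> c (Suc i) x t) (at x)"
    unfolding bessel_integrand_def by (auto intro!: derivative_eq_intros)
  show "integrable lborel (bessel_integrand \<nu> c i x)"
    using bessel_integrand_integrable assms x by simp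
  show "\<exists>d>0. \<exists>B. ball x d \<subseteq> {0<..} \<and> integrable lborel B \<and>
      (\<forall>y\<in>ball x d. \<forall>t\<in>space lborel. \<bar>bessel_integrand \<nu> c (Suc i) y t\<bar> \<le> B t)"
  proof (intro exI conjI)
    \<comment> \<open>With radius x/2 all points of the ball exceed x/2, which becomes the lower
      point \<open>y\<close> of \<open>bessel_integrand_bound\<close>.\<close>
    show "x / 2 > 0" using x by simp
    show "ball x (x / 2) \<subseteq> {0<..}" using x by (auto simp: dist_real_def abs_if split: if_splits)
    show "integrable lborel (\<lambda>t. c ^ Suc i * exp ((\<nu> + real (Suc i)) * t - (c * (x / 2) / 2) * exp t))"
      using assms x by (intro integrable_mult_right integrable_exp_exp_scale) auto
    show "\<forall>y\<in>ball x (x / 2). \<forall>t\<in>space lborel. \<bar>bessel_integrand \<nu> c (Suc i) y t\<bar>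
        \<le> c ^ Suc i * exp ((\<nu> + real (Suc i)) * t - (c * (x / 2) / 2) * exp t)"
      using assms x by (intro ballI bessel_integrand_bound) (auto simp: dist_real_def abs_if split: if_splits)
  qed
next
  fix i
  define C where "C = c ^ i * (c / 2) powr - (\<nu> + real i) * (\<integral>t. exp ((\<nu> + real i) * t - exp t) \<partial>lborel)"
  have "C \<ge> 0" using assms by (simp add: C_def)
  moreover have "\<bar>\<integral>t. bessel_integrand \<nu> c i x t \<partial>lborel\<bar> \<le> C * (x powr - \<nu> / x ^ i)" if x: "x > 0" for x
  proof -
    have "\<bar>\<integral>t. bessel_integrand \<nu> c i x t \<partial>lborel\<bar> \<le> (\<integral>t. \<bar>bessel_integrand \<nu> c i x t\<bar> \<partial>lborel)"
      by (rule integral_abs_bound)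
    also have "\<dots> \<le> (\<integral>t. c ^ i * exp ((\<nu> + real i) * t - (c * x / 2) * exp t) \<partial>lborel)"
      using assms x
      by (intro integral_mono integrable_mult_right integrable_exp_exp_scale integrable_abs
          bessel_integrand_integrable bessel_integrand_bound) auto
    also have "\<dots> = c ^ i * ((c * x / 2) powr - (\<nu> + real i) * (\<integral>t. exp ((\<nu> + real i) * t - exp t) \<partial>lborel))"
      using assms x by (subst integral_mult_right_zero, subst integral_exp_exp_scale) auto
    also have "(c * x / 2) powr - (\<nu> + real i) = (c / 2) powr - (\<nu> + real i) * x powr - (\<nu> + real i)"
      using assms x powr_mult[of "c / 2" x "- (\<nu> + real i)"] by (simp add: mult.commute)
    also have "x powr - (\<nu> + real i) = x powr - \<nu> / x ^ i"
      using x by (simp add: powr_diff powr_realpow)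
    finally show ?thesis by (simp add: C_def mult_ac)
  qed
  ultimately show "\<exists>C\<ge>0. \<forall>x\<in>{0<..}. \<bar>\<integral>t. bessel_integrand \<nu> c i x t \<partial>lborel\<bar> \<le> C * (x powr - \<nu> / x ^ i)"
    by auto
qed

text \<open>A unit interval of t where z exp t is comparable to \<open>M\<close> already contributes
  enough: the exponential factor is bounded below there, and cosh(\<nu> t) is at least (M/z)^\<nu> /
  2.\<close>

lemma bessel_K_lower:
  assumes "\<nu> > 0" "M \<ge> 1"
  shows "\<exists>b>0. \<forall>z. 0 < z \<and> z \<le> M \<longrightarrow> b * z powr - \<nu> \<le> bessel_K \<nu> z"
proof (intro exI conjI allI impI)
  show "exp (- (M * exp 1)) * M powr \<nu> / 2 > 0" using assms by auto
  fix z assume z: "0 < z \<and> z \<le> M"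
  \<comment> \<open>The left end of that interval. It is nonnegative because z \<le> M, so the
    interval lies in the domain of integration, and z cosh t \<le> M e on it.\<close>
  define a where "a = ln (M / z)"
  have a: "a \<ge> 0" "exp a = M / z" using z assms by (auto simp: a_def)
  define b where "b = exp (- (M * exp 1)) * ((M / z) powr \<nu> / 2)"
  have "(\<integral>t. indicator {a..a + 1} t * b \<partial>lborel) \<le> (\<integral>t. bessel_integrand \<nu> 1 0 z t \<partial>lborel)"
  proof (rule integral_mono)
    show "integrable lborel (\<lambda>t. indicator {a..a + 1} t * b)"
      by (intro integrable_mult_left) simp
    show "integrable lborel (bessel_integrand \<nu> 1 0 z)"
      using assms z by (intro bessel_integrand_integrable) auto
    fix t :: real
    show "indicator {a..a + 1} t * b \<le> bessel_integrand \<nu> 1 0 z t"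
    proof (cases "t \<in> {a..a + 1}")
      case True
      have "b \<le> exp (- z * cosh t) * cosh (\<nu> * t)"
        unfolding b_def
      proof (rule mult_mono)
        have "cosh t \<le> exp t" using True a by (simp add: cosh_def)
        also have "\<dots> \<le> exp (a + 1)" using True by simp
        also have "\<dots> = M / z * exp 1" using a by (simp add: exp_add)
        finally have "z * cosh t \<le> z * (M / z * exp 1)" using z by (intro mult_left_mono) auto
        then show "exp (- (M * exp 1)) \<le> exp (- z * cosh t)" using z by simp
        have "(M / z) powr \<nu> = exp (\<nu> * a)" using z assms by (simp add: powr_def a_def)
        also have "\<dots> \<le> exp (\<nu> * t)" using True assms by simp
        finally show "(M / z) powr \<nu> / 2 \<le> cosh (\<nu> * t)" by (simp add: cosh_def add_increasing2)
      qed auto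
      then show ?thesis using True a by (simp add: bessel_integrand_def)
    qed (auto simp: bessel_integrand_def indicator_def)
  qed
  moreover have "(\<integral>t. indicator {a..a + 1} t * b \<partial>lborel) = b"
    by simp
  moreover have "b = exp (- (M * exp 1)) * M powr \<nu> / 2 * z powr - \<nu>"
    using z assms powr_divide[of M z \<nu>] by (simp add: b_def powr_minus_divide)
  ultimately show "exp (- (M * exp 1)) * M powr \<nu> / 2 * z powr - \<nu> \<le> bessel_K \<nu> z"
    using bessel_K_eq[of \<nu> 1 z] by simp
qed

section \<open>Even extension and the radial transform\<close>

lemma symbol_on_powr: "symbol_on {0<..} (\<lambda>x. x) n (\<lambda>x. x powr a) (\<lambda>x. x powr a)"
proof (induction n arbitrary: a)
  case 0
  then show ?case by (auto intro!: exI[of _ 1])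
next
  case (Suc n)
  have "symbol_on {0<..} (\<lambda>x. x) n (\<lambda>x. 1 * x powr (a - 1)) (\<lambda>x. a * x powr (a - 1))"
    by (rule symbol_on_mult[OF symbol_on_const[where K = "\<bar>a\<bar>"] Suc.IH]) auto
  then have "symbol_on {0<..} (\<lambda>x. x) n (\<lambda>x. x powr a / x) (\<lambda>x. a * x powr (a - 1))"
    by (rule symbol_on_cong_weight) (auto simp: powr_diff)
  then show ?case
    by (rule symbol_on_SucI[of 1, rotated 3]) (auto intro!: derivative_eq_intros)
qed

lemma has_real_derivative_abs:
  fixes x :: real
  assumes "x \<noteq> 0"
  shows "(abs has_real_derivative sgn x) (at x)"
proof (cases "x > 0")
  case True
  show ?thesis
    by (rule has_field_derivative_transform_within_open[of "\<lambda>x. x" _ _ "{0<..}"])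
      (use True in \<open>auto intro!: derivative_eq_intros\<close>)
next
  case False
  show ?thesis
    by (rule has_field_derivative_transform_within_open[of "\<lambda>x. - x" _ _ "{..<0}"])
      (use False assms in \<open>auto intro!: derivative_eq_intros\<close>)
qed

text \<open>The chain rule produces f'(|x|) times the sign of x. Away from 0 the sign is locally
  constant, so it is a symbol of weight 1 and the product rule applies.\<close>

lemma symbol_on_abs:
  assumes "symbol_on {0<..} (\<lambda>x. x) n u f" "\<And>x. x > 0 \<Longrightarrow> u x \<ge> 0"
  shows "symbol_on (- {0}) abs n (\<lambda>x. u \<bar>x\<bar>) (\<lambda>x. f \<bar>x\<bar>)"
  using assms
proof (induction n arbitrary: u f)
  case 0
  then obtain C where "C \<ge> 0" "\<forall>x\<in>{0<..}. \<bar>f x\<bar> \<le> C * u x" by auto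
  then show ?case by (auto intro!: exI[of _ C])
next
  case (Suc n)
  from Suc.prems(1) obtain C f' where f': "C \<ge> 0" "\<And>x. x \<in> {0<..} \<Longrightarrow> \<bar>f x\<bar> \<le> C * u x"
    "\<And>x. x \<in> {0<..} \<Longrightarrow> (f has_real_derivative f' x) (at x)"
    "symbol_on {0<..} (\<lambda>x. x) n (\<lambda>x. u x / x) f'"
    unfolding symbol_on.simps by blast
  have "symbol_on (- {0}) abs n (\<lambda>_. 1) sgn" for n
  proof (cases n)
    case 0
    then show ?thesis by (auto simp: abs_sgn_eq intro!: exI[of _ 1])
  next
    case (Suc m)
    have "(sgn has_real_derivative 0) (at x)" if "x \<noteq> 0" for x :: real
    proof (cases "x > 0")
      case True
      show ?thesis
        by (rule has_field_derivative_transform_within_open[OF DERIV_const[of 1], of "{0<..}"]) (use True in auto)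
    next
      case False
      show ?thesis
        by (rule has_field_derivative_transform_within_open[OF DERIV_const[of "-1"], of "{..<0}"])
          (use False that in auto)
    qed
    then show ?thesis unfolding Suc
      by (intro symbol_on_SucI[where C = 1 and f' = "\<lambda>_. 0"] symbol_on_const[where K = 0])
        (auto simp: abs_sgn_eq)
  qed
  from symbol_on_mult[OF this Suc.IH[OF f'(4)]] Suc.prems(2)
  have "symbol_on (- {0}) abs n (\<lambda>x. u \<bar>x\<bar> / \<bar>x\<bar>) (\<lambda>x. sgn x * f' \<bar>x\<bar>)" by simp
  then show ?case
  proof (rule symbol_on_SucI[OF f'(1), rotated 2])
    fix x :: real assume x: "x \<in> - {0}"
    show "\<bar>f \<bar>x\<bar>\<bar> \<le> C * u \<bar>x\<bar>" using f'(2)[of "\<bar>x\<bar>"] x by auto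
    have "((\<lambda>x. f \<bar>x\<bar>) has_real_derivative f' \<bar>x\<bar> * sgn x) (at x)"
      by (rule DERIV_chain2[OF f'(3) has_real_derivative_abs]) (use x in auto)
    then show "((\<lambda>x. f \<bar>x\<bar>) has_real_derivative sgn x * f' \<bar>x\<bar>) (at x)" by (simp add: mult.commute)
  qed
qed

text \<open>The transform \<open>multiquadric_hat\<close> without its constant factor, which cancels
  in the quotient. Removing it also removes the sign of Gamma(-\<alpha>) and leaves a nonnegative
  function.\<close>

definition radial_hat :: "real \<Rightarrow> real \<Rightarrow> real \<Rightarrow> real" where
  "radial_hat \<nu> c x = \<bar>x\<bar> powr - \<nu> * bessel_K \<nu> (c * \<bar>x\<bar>)"

lemma radial_hat_nonneg: "radial_hat \<nu> c x \<ge> 0"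
  unfolding radial_hat_def bessel_K_eq
  by (intro mult_nonneg_nonneg integral_nonneg_AE) (auto simp: bessel_integrand_def cosh_def)

lemma symbol_on_radial_hat:
  assumes "c > 0" "\<nu> > 0"
  shows "symbol_on (- {0}) abs n (\<lambda>x. \<bar>x\<bar> powr (- 2 * \<nu>)) (radial_hat \<nu> c)"
proof -
  have "symbol_on {0<..} (\<lambda>x. x) n (\<lambda>x. x powr - \<nu> * x powr - \<nu>) (\<lambda>x. x powr - \<nu> * bessel_K \<nu> (c * x))"
    by (intro symbol_on_mult symbol_on_powr symbol_on_bessel_K assms) auto
  from symbol_on_abs[OF this] show ?thesis
    by (simp add: radial_hat_def[abs_def] flip: powr_add)
qed

lemma radial_hat_lower:
  assumes "c > 0" "\<nu> > 0" "R > 0"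
  shows "\<exists>b>0. \<forall>x. x \<noteq> 0 \<and> \<bar>x\<bar> \<le> R \<longrightarrow> b * \<bar>x\<bar> powr (- 2 * \<nu>) \<le> radial_hat \<nu> c x"
proof -
  \<comment> \<open>\<open>bessel_K_lower\<close> asks for an upper end of at least 1, hence the
    maximum.\<close>
  obtain b where b: "b > 0" "\<And>z. 0 < z \<Longrightarrow> z \<le> max 1 (c * R) \<Longrightarrow> b * z powr - \<nu> \<le> bessel_K \<nu> z"
    using bessel_K_lower[of \<nu> "max 1 (c * R)"] assms by auto
  show ?thesis
  proof (intro exI[of _ "b * c powr - \<nu>"] conjI allI impI)
    show "b * c powr - \<nu> > 0" using b assms by simp
    fix x assume x: "x \<noteq> 0 \<and> \<bar>x\<bar> \<le> R"
    have "c * \<bar>x\<bar> \<le> max 1 (c * R)" using x assms by (simp add: le_max_iff_disj)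
    then have "b * (c * \<bar>x\<bar>) powr - \<nu> \<le> bessel_K \<nu> (c * \<bar>x\<bar>)"
      using assms x by (intro b) auto
    then have "\<bar>x\<bar> powr - \<nu> * (b * (c * \<bar>x\<bar>) powr - \<nu>) \<le> radial_hat \<nu> c x"
      unfolding radial_hat_def by (intro mult_left_mono) auto
    moreover have "(c * \<bar>x\<bar>) powr - \<nu> = c powr - \<nu> * \<bar>x\<bar> powr - \<nu>"
      using assms by (simp add: powr_mult)
    moreover have "\<bar>x\<bar> powr (- 2 * \<nu>) = \<bar>x\<bar> powr - \<nu> * \<bar>x\<bar> powr - \<nu>"
      by (simp flip: powr_add)
    ultimately show "b * c powr - \<nu> * \<bar>x\<bar> powr (- 2 * \<nu>) \<le> radial_hat \<nu> c x"
      by (simp add: mult_ac)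
  qed
qed

subsection \<open>Periodization\<close>

definition off_lattice :: "real set" where
  "off_lattice = {x. x / (2 * pi) \<notin> \<int>}"

text \<open>The distance to 2 pi Z, written through \<open>round\<close> so that a nearest lattice
  point is explicit.\<close>

definition lattice_dist :: "real \<Rightarrow> real" where
  "lattice_dist x = 2 * pi * \<bar>x / (2 * pi) - of_int (round (x / (2 * pi)))\<bar>"

lemma open_off_lattice: "open off_lattice"
proof -
  have "open ((\<lambda>x. x / (2 * pi)) -` (- \<int>))"
    by (intro open_vimage continuous_intros) (auto simp: closed_Ints)
  also have "(\<lambda>x. x / (2 * pi)) -` (- \<int>) = off_lattice"
    by (auto simp: off_lattice_def)
  finally show ?thesis .
qed

lemma off_lattice_shift_neq:
  assumes "x \<in> off_lattice"
  shows "x + 2 * pi * of_int j \<noteq> 0"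
proof
  assume "x + 2 * pi * of_int j = 0"
  then have "x / (2 * pi) = of_int (- j)" by (simp add: field_simps)
  then show False using assms unfolding off_lattice_def by (metis Ints_of_int mem_Collect_eq)
qed

lemma lattice_dist_le: "lattice_dist x \<le> \<bar>x + 2 * pi * of_int j\<bar>"
proof -
  have "lattice_dist x \<le> 2 * pi * \<bar>x / (2 * pi) - of_int (- j)\<bar>"
    unfolding lattice_dist_def by (intro mult_left_mono round_diff_minimal) simp
  also have "\<dots> = \<bar>2 * pi * (x / (2 * pi) - of_int (- j))\<bar>" by (simp add: abs_mult)
  also have "2 * pi * (x / (2 * pi) - of_int (- j)) = x + 2 * pi * of_int j" by (simp add: field_simps)
  finally show ?thesis .
qed

lemma lattice_dist_le_abs: "lattice_dist x \<le> \<bar>x\<bar>"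
  using lattice_dist_le[of x 0] by simp

lemma lattice_dist_nearest: "lattice_dist x = \<bar>x + 2 * pi * of_int (- round (x / (2 * pi)))\<bar>"
proof -
  have "lattice_dist x = \<bar>2 * pi * (x / (2 * pi) - of_int (round (x / (2 * pi))))\<bar>"
    by (simp add: lattice_dist_def abs_mult)
  also have "2 * pi * (x / (2 * pi) - of_int (round (x / (2 * pi)))) = x + 2 * pi * of_int (- round (x / (2 * pi)))"
    by (simp add: field_simps)
  finally show ?thesis .
qed

lemma lattice_dist_pos: "x \<in> off_lattice \<Longrightarrow> 0 < lattice_dist x"
  unfolding lattice_dist_nearest by (simp only: zero_less_abs_iff off_lattice_shift_neq not_False_eq_True)

lemma lattice_dist_le_pi: "lattice_dist x \<le> pi"
proof -
  have "\<bar>x / (2 * pi) - of_int (round (x / (2 * pi)))\<bar> \<le> 1 / 2"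
    using of_int_round_abs_le[of "x / (2 * pi)"] by (simp add: abs_minus_commute)
  then show ?thesis using pi_gt_zero by (simp add: lattice_dist_def)
qed

text \<open>Separates the dependence on \<open>x\<close> from that on the summation index. With h
  the offset from the nearest lattice point and m the recentred index, |h| \<le> pi gives |h + 2 pi
  m| \<ge> 2 pi |m| - pi \<ge> pi |m| \<ge> |h| |m| for m \<noteq> 0.\<close>

lemma lattice_shift_lower:
  "lattice_dist x * max 1 \<bar>of_int (j + round (x / (2 * pi)))\<bar> \<le> \<bar>x + 2 * pi * of_int j\<bar>"
proof -
  define k where "k = round (x / (2 * pi))"
  define h where "h = x + 2 * pi * of_int (- k)"
  have h: "\<bar>h\<bar> = lattice_dist x" unfolding h_def k_def lattice_dist_nearest ..
  have hpi: "\<bar>h\<bar> \<le> pi" using h lattice_dist_le_pi[of x] by simp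
  have x: "x + 2 * pi * of_int j = h + 2 * pi * of_int (j + k)" by (simp add: h_def algebra_simps)
  show ?thesis
  proof (cases "j + k = 0")
    case True
    then show ?thesis unfolding x by (simp add: h flip: k_def)
  next
    case False
    then have 1: "\<bar>of_int (j + k)\<bar> \<ge> (1 :: real)" by linarith
    have "\<bar>h\<bar> * \<bar>of_int (j + k)\<bar> \<le> pi * \<bar>of_int (j + k)\<bar>"
      using hpi by (intro mult_right_mono) auto
    also have "\<dots> \<le> 2 * pi * \<bar>of_int (j + k)\<bar> - pi"
      using mult_left_mono[OF 1, of pi] by simp
    also have "\<dots> \<le> \<bar>2 * pi * of_int (j + k)\<bar> - \<bar>h\<bar>"
      using hpi by (simp add: abs_mult)
    also have "\<dots> \<le> \<bar>h + 2 * pi * of_int (j + k)\<bar>" by linarith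
    finally show ?thesis unfolding x using 1 by (simp add: h flip: k_def)
  qed
qed

section \<open>Sums over the shifted lattice\<close>

text \<open>Sums over the integers are treated as integrals over \<open>count_space\<close>, to
  which \<open>symbol_on_integral\<close> applies. The integers are covered by the naturals and
  their negatives, and the summand is even.\<close>

lemma integrable_int_powr:
  fixes p :: real
  assumes "p > 1"
  shows "integrable (count_space UNIV) (\<lambda>j::int. max 1 \<bar>of_int j\<bar> powr - p)"
proof -
  define q where "q = (\<lambda>j::int. max 1 \<bar>of_int j\<bar> powr - p :: real)"
  have "summable (\<lambda>n. real n powr - p)" using assms by (simp add: summable_real_powr_iff)
  then have "summable (\<lambda>n. norm (q (int n)))"
    by (rule summable_comparison_test_ev[rotated])
      (auto simp: q_def max_def intro!: eventually_mono[OF eventually_gt_at_top[of 0]])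
  then have nat: "integrable (count_space UNIV) (\<lambda>n. q (int n))"
    by (simp add: integrable_count_space_nat_iff)
  then have "Infinite_Set_Sum.abs_summable_on q (range int)"
    by (intro abs_summable_on_reindex) (simp add: Infinite_Set_Sum.abs_summable_on_def)
  moreover have "Infinite_Set_Sum.abs_summable_on q (range (\<lambda>n. - int n))"
    using nat by (intro abs_summable_on_reindex) (simp add: Infinite_Set_Sum.abs_summable_on_def q_def)
  ultimately have "Infinite_Set_Sum.abs_summable_on q (range int \<union> range (\<lambda>n. - int n))"
    by (rule abs_summable_on_union)
  moreover have "range int \<union> range (\<lambda>n. - int n) = UNIV"
  proof -
    have "j \<in> range int \<union> range (\<lambda>n. - int n)" for j
      by (cases j rule: int_cases2) auto
    then show ?thesis by blast
  qed
  ultimately show ?thesis by (simp add: Infinite_Set_Sum.abs_summable_on_def q_def)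
qed

text \<open>By \<open>lattice_shift_lower\<close>, after recentring the index at the nearest lattice
  point, the sum is dominated by a power of \<open>lattice_dist x\<close> times a convergent series
  independent of \<open>x\<close>.\<close>

lemma
  fixes p :: real
  assumes "p > 1" "x \<in> off_lattice"
  shows integrable_lattice_shift: "integrable (count_space J) (\<lambda>j::int. \<bar>x + 2 * pi * of_int j\<bar> powr - p)"
    and integral_lattice_shift_le: "(\<integral>j. \<bar>x + 2 * pi * of_int j\<bar> powr - p \<partial>count_space (UNIV :: int set))
      \<le> (\<integral>j. max 1 \<bar>of_int j\<bar> powr - p \<partial>count_space (UNIV :: int set)) * lattice_dist x powr - p"
proof -
  define k where "k = round (x / (2 * pi))"
  define q where "q = (\<lambda>j::int. max 1 \<bar>of_int j\<bar> powr - p :: real)"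
  have bij: "bij_betw (\<lambda>j. j + k) UNIV UNIV"
    by (rule bij_betwI[where g = "\<lambda>j. j - k"]) auto
  have q: "integrable (count_space UNIV) (\<lambda>j. q (j + k))"
    using abs_summable_on_reindex_bij_betw[OF bij, of q] integrable_int_powr[OF assms(1)]
    by (simp add: Infinite_Set_Sum.abs_summable_on_def q_def)
  have q_eq: "(\<integral>j. q (j + k) \<partial>count_space UNIV) = (\<integral>j. q j \<partial>count_space UNIV)"
    using infsetsum_reindex_bij_betw[OF bij, of q] by (simp add: infsetsum_def)
  have w: "lattice_dist x > 0" by (rule lattice_dist_pos[OF assms(2)])
  have le: "\<bar>x + 2 * pi * of_int j\<bar> powr - p \<le> q (j + k) * lattice_dist x powr - p" for j
  proof -
    have "\<bar>x + 2 * pi * of_int j\<bar> powr - p \<le> (lattice_dist x * max 1 \<bar>of_int (j + k)\<bar>) powr - p"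
      unfolding k_def using w assms(1) by (intro powr_mono2' lattice_shift_lower) auto
    also have "\<dots> = q (j + k) * lattice_dist x powr - p"
      using w by (simp add: powr_mult q_def)
    finally show ?thesis .
  qed
  have int: "integrable (count_space UNIV) (\<lambda>j::int. \<bar>x + 2 * pi * of_int j\<bar> powr - p)"
    by (rule Bochner_Integration.integrable_bound[OF integrable_mult_left[OF q, of "lattice_dist x powr - p"]])
      (use le in \<open>auto simp: q_def\<close>)
  then show "integrable (count_space J) (\<lambda>j::int. \<bar>x + 2 * pi * of_int j\<bar> powr - p)"
    using abs_summable_on_subset[of _ UNIV J] by (auto simp: Infinite_Set_Sum.abs_summable_on_def)
  have "(\<integral>j. \<bar>x + 2 * pi * of_int j\<bar> powr - p \<partial>count_space (UNIV :: int set))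
      \<le> (\<integral>j. q (j + k) * lattice_dist x powr - p \<partial>count_space UNIV)"
    by (intro integral_mono int le integrable_mult_left q)
  also have "\<dots> = (\<integral>j. q j \<partial>count_space UNIV) * lattice_dist x powr - p"
    by (simp add: q_eq)
  finally show "(\<integral>j. \<bar>x + 2 * pi * of_int j\<bar> powr - p \<partial>count_space (UNIV :: int set))
      \<le> (\<integral>j. max 1 \<bar>of_int j\<bar> powr - p \<partial>count_space (UNIV :: int set)) * lattice_dist x powr - p"
    by (simp add: q_def)
qed

text \<open>Each differentiation costs a term at most a factor 1/|x + 2 pi j| \<le>
  1/\<open>lattice_dist x\<close>, so a bound for the sum of the undifferentiated powers controls
  every order. The index set \<open>J\<close> is free because both the full sum and the sum without
  j = 0 are needed.\<close>

lemma symbol_on_lattice_sum: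
  fixes p :: real
  assumes g: "symbol_on (- {0}) abs n (\<lambda>x. \<bar>x\<bar> powr - p) g" and "p > 1"
    and V: "open V" "V \<subseteq> off_lattice" and "K \<ge> 0"
    and bound: "\<And>x. x \<in> V \<Longrightarrow> (\<integral>j. \<bar>x + 2 * pi * of_int j\<bar> powr - p \<partial>count_space J) \<le> K * u x"
  shows "symbol_on V lattice_dist n u (\<lambda>x. \<integral>j. g (x + 2 * pi * of_int j) \<partial>count_space (J :: int set))"
proof -
  obtain F where F: "F 0 = g"
    "\<And>i x. i < n \<Longrightarrow> x \<noteq> 0 \<Longrightarrow> (F i has_real_derivative F (Suc i) x) (at x)"
    "\<And>i. i \<le> n \<Longrightarrow> \<exists>C\<ge>0. \<forall>x\<in>-{0}. \<bar>F i x\<bar> \<le> C * (\<bar>x\<bar> powr - p / \<bar>x\<bar> ^ i)"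
    using symbol_on_derivatives[OF g] by auto
  have Fle: "\<exists>C\<ge>0. \<forall>x\<in>V. \<forall>j. \<bar>F i (x + 2 * pi * of_int j)\<bar>
      \<le> C / lattice_dist x ^ i * \<bar>x + 2 * pi * of_int j\<bar> powr - p" if i: "i \<le> n" for i
  proof -
    obtain C where C: "C \<ge> 0" "\<And>x. x \<noteq> 0 \<Longrightarrow> \<bar>F i x\<bar> \<le> C * (\<bar>x\<bar> powr - p / \<bar>x\<bar> ^ i)"
      using F(3)[OF i] by auto
    have "\<bar>F i (x + 2 * pi * of_int j)\<bar> \<le> C / lattice_dist x ^ i * \<bar>x + 2 * pi * of_int j\<bar> powr - p"
      if x: "x \<in> V" for x j
    proof -
      have x': "x \<in> off_lattice" using x V by auto
      have "\<bar>F i (x + 2 * pi * of_int j)\<bar>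
          \<le> C * (\<bar>x + 2 * pi * of_int j\<bar> powr - p / \<bar>x + 2 * pi * of_int j\<bar> ^ i)"
        by (rule C(2)[OF off_lattice_shift_neq[OF x']])
      also have "\<dots> \<le> C * (\<bar>x + 2 * pi * of_int j\<bar> powr - p / lattice_dist x ^ i)"
        using C(1) lattice_dist_pos[OF x'] lattice_dist_le[of x j]
        by (intro mult_left_mono divide_left_mono power_mono mult_pos_pos zero_less_power) auto
      finally show ?thesis by simp
    qed
    then show ?thesis using C(1) by auto
  qed
  have int: "integrable (count_space J) (\<lambda>j. F i (x + 2 * pi * of_int j))" if xV: "x \<in> V" and i: "i \<le> n" for i x
  proof -
    obtain C where C: "C \<ge> 0" "\<forall>x\<in>V. \<forall>j. \<bar>F i (x + 2 * pi * of_int j)\<bar>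
      \<le> C / lattice_dist x ^ i * \<bar>x + 2 * pi * of_int j\<bar> powr - p" using Fle[OF i] by blast
    have "x \<in> off_lattice" using xV V by auto
    note dominant = integrable_mult_right[OF integrable_lattice_shift[OF \<open>p > 1\<close> this, of J], of "C / lattice_dist x ^ i"]
    show ?thesis
    proof (rule Bochner_Integration.integrable_bound[OF dominant])
      show "AE j in count_space J. norm (F i (x + 2 * pi * of_int j))
          \<le> norm (C / lattice_dist x ^ i * \<bar>x + 2 * pi * of_int j\<bar> powr - p)"
        using C(2) xV unfolding real_norm_def by (intro AE_I2) (meson abs_ge_self order_trans)
    qed auto
  qed
  have "symbol_on V lattice_dist n u (\<lambda>x. \<integral>j. F 0 (x + 2 * pi * of_int j) \<partial>count_space J)"
  proof (rule symbol_on_integral[where f = "\<lambda>i x j. F i (x + 2 * pi * of_int j)"])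
    fix i x assume x: "x \<in> V"
    then have x': "x \<in> off_lattice" using V by auto
    show "integrable (count_space J) (\<lambda>j. F i (x + 2 * pi * of_int j))" if "i \<le> n"
      using int x that by blast
    show "((\<lambda>x. F i (x + 2 * pi * of_int j)) has_real_derivative F (Suc i) (x + 2 * pi * of_int j)) (at x)"
      if "i < n" for j :: int
      using F(2)[OF that off_lattice_shift_neq[OF x']] by (simp add: DERIV_shift)
    assume i: "i < n"
    obtain C where C: "C \<ge> 0" "\<And>x. x \<noteq> 0 \<Longrightarrow> \<bar>F (Suc i) x\<bar> \<le> C * (\<bar>x\<bar> powr - p / \<bar>x\<bar> ^ Suc i)"
      using F(3)[of "Suc i"] i by auto
    obtain e where e: "e > 0" "ball x e \<subseteq> V" using V(1) x by (meson openE)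
    define w where "w = lattice_dist x"
    have w: "w > 0" using lattice_dist_pos[OF x'] by (simp add: w_def)
    \<comment> \<open>Moving \<open>x\<close> by less than w/2 changes x + 2 pi j by less than half
      its absolute value, which is at least \<open>w\<close>. Hence |y + 2 pi j| \<ge> |x + 2 pi j|
      / 2, and this accounts for the factor \<open>2 powr p\<close> and the denominator with
      w/2.\<close>
    define B where "B = (\<lambda>j. C * 2 powr p / (w / 2) ^ Suc i * \<bar>x + 2 * pi * of_int j\<bar> powr - p)"
    show "\<exists>d>0. \<exists>B. ball x d \<subseteq> V \<and> integrable (count_space J) B \<and>
        (\<forall>y\<in>ball x d. \<forall>j\<in>space (count_space J). \<bar>F (Suc i) (y + 2 * pi * of_int j)\<bar> \<le> B j)"
    proof (intro exI conjI ballI)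
      show "min e (w / 2) > 0" using e w by simp
      show "ball x (min e (w / 2)) \<subseteq> V" using e by auto
      show "integrable (count_space J) B"
        unfolding B_def by (intro integrable_mult_right integrable_lattice_shift[OF \<open>p > 1\<close> x'])
      fix y j assume y: "y \<in> ball x (min e (w / 2))"
      have xj: "w \<le> \<bar>x + 2 * pi * of_int j\<bar>" unfolding w_def by (rule lattice_dist_le)
      have "\<bar>u\<bar> / 2 \<le> \<bar>v\<bar>" if "w \<le> \<bar>u\<bar>" "\<bar>u - v\<bar> < w / 2" for u v
        using that by linarith
      from this[OF xj, of "y + 2 * pi * of_int j"]
      have yj: "\<bar>x + 2 * pi * of_int j\<bar> / 2 \<le> \<bar>y + 2 * pi * of_int j\<bar>"
        using y by (simp add: dist_real_def)
      then have yj': "w / 2 \<le> \<bar>y + 2 * pi * of_int j\<bar>"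
        using order_trans[OF _ yj, of "w / 2"] xj by simp
      have "\<bar>F (Suc i) (y + 2 * pi * of_int j)\<bar>
          \<le> C * (\<bar>y + 2 * pi * of_int j\<bar> powr - p / \<bar>y + 2 * pi * of_int j\<bar> ^ Suc i)"
        using yj' w by (intro C(2)) auto
      also have "\<dots> \<le> C * ((\<bar>x + 2 * pi * of_int j\<bar> / 2) powr - p / (w / 2) ^ Suc i)"
        using yj yj' w xj C(1) \<open>p > 1\<close>
        by (intro mult_left_mono frac_le power_mono powr_mono2') auto
      also have "(\<bar>x + 2 * pi * of_int j\<bar> / 2) powr - p = 2 powr p * \<bar>x + 2 * pi * of_int j\<bar> powr - p"
        using powr_divide[of "\<bar>x + 2 * pi * of_int j\<bar>" 2 "- p"]
        by (simp add: powr_minus_divide)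
      finally show "\<bar>F (Suc i) (y + 2 * pi * of_int j)\<bar> \<le> B j" by (simp add: B_def mult_ac)
    qed
  next
    fix i assume i: "i \<le> n"
    obtain C where C: "C \<ge> 0" "\<And>x j. x \<in> V \<Longrightarrow> \<bar>F i (x + 2 * pi * of_int j)\<bar>
      \<le> C / lattice_dist x ^ i * \<bar>x + 2 * pi * of_int j\<bar> powr - p" using Fle[OF i] by blast
    have "\<bar>\<integral>j. F i (x + 2 * pi * of_int j) \<partial>count_space J\<bar> \<le> (C * K) * (u x / lattice_dist x ^ i)"
      if x: "x \<in> V" for x
    proof -
      have x': "x \<in> off_lattice" using x V by auto
      have w: "lattice_dist x > 0" using lattice_dist_pos[OF x'] .
      have "\<bar>\<integral>j. F i (x + 2 * pi * of_int j) \<partial>count_space J\<bar>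
          \<le> (\<integral>j. \<bar>F i (x + 2 * pi * of_int j)\<bar> \<partial>count_space J)"
        by (rule integral_abs_bound)
      also have "\<dots> \<le> (\<integral>j. C / lattice_dist x ^ i * \<bar>x + 2 * pi * of_int j\<bar> powr - p \<partial>count_space J)"
        by (intro integral_mono integrable_mult_right integrable_abs int[OF x i]
            integrable_lattice_shift[OF \<open>p > 1\<close> x'] C(2)[OF x])
      also have "\<dots> = C / lattice_dist x ^ i * (\<integral>j. \<bar>x + 2 * pi * of_int j\<bar> powr - p \<partial>count_space J)"
        by simp
      also have "\<dots> \<le> C / lattice_dist x ^ i * (K * u x)"
        using C(1) w by (intro mult_left_mono bound[OF x]) auto
      finally show ?thesis by (simp add: mult_ac)
    qed
    then show "\<exists>C\<ge>0. \<forall>x\<in>V. \<bar>\<integral>j. F i (x + 2 * pi * of_int j) \<partial>count_space J\<bar>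
        \<le> C * (u x / lattice_dist x ^ i)"
      using C(1) \<open>K \<ge> 0\<close> by (intro exI[of _ "C * K"]) auto
  qed
  then show ?thesis by (simp add: F(1))
qed

lemma integral_count_space_remove:
  fixes h :: "'a \<Rightarrow> real"
  assumes "integrable (count_space UNIV) h"
  shows "(\<integral>j. h j \<partial>count_space UNIV) = h a + (\<integral>j. h j \<partial>count_space (- {a}))"
proof -
  have "Infinite_Set_Sum.abs_summable_on h (- {a})"
    using assms abs_summable_on_subset[of h UNIV "- {a}"] by (auto simp: Infinite_Set_Sum.abs_summable_on_def)
  then have "infsetsum h ({a} \<union> - {a}) = infsetsum h {a} + infsetsum h (- {a})"
    by (intro infsetsum_Un_disjoint) auto
  moreover have "{a} \<union> - {a} = UNIV" by auto
  ultimately show ?thesis by (simp add: infsetsum_def lebesgue_integral_count_space_finite)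
qed

section \<open>The quotient by the periodization\<close>

text \<open>An integral over \<open>count_space\<close>, for termwise differentiation;
  \<open>fundamental_quotient_eq\<close> identifies it with the infinite sum of the
  quotient.\<close>

definition periodization :: "(real \<Rightarrow> real) \<Rightarrow> real \<Rightarrow> real" where
  "periodization g x = (\<integral>j. g (x + 2 * pi * of_int j) \<partial>count_space (UNIV :: int set))"

lemma integrable_periodization:
  fixes p :: real
  assumes g: "symbol_on (- {0}) abs n (\<lambda>x. \<bar>x\<bar> powr - p) g" and "p > 1" "x \<in> off_lattice"
  shows "integrable (count_space UNIV) (\<lambda>j::int. g (x + 2 * pi * of_int j))"
proof -
  obtain C where C: "C \<ge> 0" "\<And>x. x \<noteq> 0 \<Longrightarrow> \<bar>g x\<bar> \<le> C * \<bar>x\<bar> powr - p"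
    using symbol_on_bound[OF g] by auto
  have "integrable (count_space UNIV) (\<lambda>j::int. C * \<bar>x + 2 * pi * of_int j\<bar> powr - p)"
    by (intro integrable_mult_right integrable_lattice_shift assms)
  then show ?thesis
    by (rule Bochner_Integration.integrable_bound)
      (use C off_lattice_shift_neq[OF assms(3)] in auto)
qed

lemma symbol_on_quotient:
  fixes p :: real
  assumes g: "symbol_on (- {0}) abs n (\<lambda>x. \<bar>x\<bar> powr - p) g" and "p > 1"
    and nonneg: "\<And>x. g x \<ge> 0"
    and "b > 0" and lower: "\<And>x. x \<noteq> 0 \<Longrightarrow> \<bar>x\<bar> \<le> pi \<Longrightarrow> b * \<bar>x\<bar> powr - p \<le> g x"
  shows "symbol_on off_lattice lattice_dist n (\<lambda>x. \<bar>x\<bar> powr - p * lattice_dist x powr p)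
           (\<lambda>x. g x / periodization g x)" (is ?far)
    and "symbol_on (off_lattice \<inter> {-pi<..<pi}) lattice_dist n (\<lambda>x. lattice_dist x powr p)
           (\<lambda>x. 1 - g x / periodization g x)" (is ?near)
proof -
  define Z where "Z = (\<integral>j. max 1 \<bar>of_int j\<bar> powr - p \<partial>count_space (UNIV :: int set))"
  have Z: "Z \<ge> 0" unfolding Z_def by (intro integral_nonneg_AE) auto
  have P: "symbol_on off_lattice lattice_dist n (\<lambda>x. lattice_dist x powr - p) (periodization g)"
    unfolding periodization_def
    by (rule symbol_on_lattice_sum[OF g \<open>p > 1\<close> open_off_lattice subset_refl Z])
      (use integral_lattice_shift_le[OF \<open>p > 1\<close>] in \<open>auto simp: Z_def\<close>)
  have rem: "periodization g x = g (x + 2 * pi * of_int k) + (\<integral>j. g (x + 2 * pi * of_int j) \<partial>count_space (- {k}))"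
    if "x \<in> off_lattice" for x k
    unfolding periodization_def
    by (rule integral_count_space_remove[OF integrable_periodization[OF g \<open>p > 1\<close> that]])
  have Plower: "b * lattice_dist x powr - p \<le> periodization g x" if x: "x \<in> off_lattice" for x
  proof -
    \<comment> \<open>The shift that carries \<open>x\<close> to within pi of 0, where
      \<open>lower\<close> applies; the other terms are nonnegative.\<close>
    define k where "k = - round (x / (2 * pi))"
    have "0 \<le> (\<integral>j. g (x + 2 * pi * of_int j) \<partial>count_space (- {k}))"
      by (intro integral_nonneg_AE) (auto simp: nonneg)
    moreover have "b * \<bar>x + 2 * pi * of_int k\<bar> powr - p \<le> g (x + 2 * pi * of_int k)"
      using lattice_dist_nearest[of x] lattice_dist_le_pi[of x]
      by (intro lower off_lattice_shift_neq[OF x]) (simp add: k_def)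
    moreover have "lattice_dist x = \<bar>x + 2 * pi * of_int k\<bar>" by (simp only: lattice_dist_nearest k_def)
    ultimately show ?thesis using rem[OF x, of k] by simp
  qed
  have P0: "periodization g x > 0" if "x \<in> off_lattice" for x
    using lattice_dist_pos[OF that] \<open>b > 0\<close> by (intro less_le_trans[OF _ Plower[OF that]]) auto
  have "symbol_on off_lattice lattice_dist n (\<lambda>x. 1 / lattice_dist x powr - p) (\<lambda>x. 1 / periodization g x)"
    by (rule symbol_on_inverse[OF P \<open>b > 0\<close>]) (use Plower lattice_dist_pos in \<open>force simp: abs_if\<close>)+
  then have inv: "symbol_on off_lattice lattice_dist n (\<lambda>x. lattice_dist x powr p) (\<lambda>x. 1 / periodization g x)"
    by (rule symbol_on_cong_weight) (use lattice_dist_pos in \<open>auto simp: powr_minus_divide\<close>)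
  have "symbol_on off_lattice lattice_dist n (\<lambda>x. \<bar>x\<bar> powr - p) g"
    by (rule symbol_on_mono[OF g, where K = 1])
      (use lattice_dist_pos lattice_dist_le_abs off_lattice_shift_neq[of _ 0] in auto)
  from symbol_on_mult[OF this inv] show ?far
    using lattice_dist_pos by simp
  let ?V = "off_lattice \<inter> {-pi<..<pi}"
  \<comment> \<open>The periodization without its term singular at 0. On the interval around 0 it is
    a symbol of weight 1, and 1 - g/P = S/P.\<close>
  define S where "S x = (\<integral>j. g (x + 2 * pi * of_int j) \<partial>count_space (- {0::int}))" for x
  have "symbol_on ?V lattice_dist n (\<lambda>_. 1) S"
    unfolding S_def
  proof (rule symbol_on_lattice_sum[OF g \<open>p > 1\<close> _ _ Z])
    show "open ?V" using open_off_lattice by auto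
    fix x assume x: "x \<in> ?V"
    \<comment> \<open>For |x| < pi and j \<noteq> 0 one has |x + 2 pi j| \<ge> 2 pi |j| - pi \<ge>
      pi |j| \<ge> |j|, uniformly in \<open>x\<close>.\<close>
    have le: "\<bar>x + 2 * pi * of_int j\<bar> powr - p \<le> max 1 \<bar>of_int j\<bar> powr - p" if "j \<noteq> 0" for j :: int
    proof (rule powr_mono2')
      have 1: "\<bar>of_int j\<bar> \<ge> (1 :: real)" using that by linarith
      have "\<bar>of_int j\<bar> \<le> pi * \<bar>of_int j :: real\<bar>"
        using mult_right_mono[of 1 pi "\<bar>of_int j :: real\<bar>"] pi_gt3 by simp
      also have "\<dots> \<le> 2 * pi * \<bar>of_int j\<bar> - pi"
        using mult_left_mono[OF 1, of pi] by simp
      also have "\<dots> \<le> \<bar>2 * pi * of_int j\<bar> - \<bar>x\<bar>" using x by (auto simp: abs_mult)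
      also have "\<dots> \<le> \<bar>x + 2 * pi * of_int j\<bar>" by linarith
      finally show "max 1 \<bar>of_int j\<bar> \<le> \<bar>x + 2 * pi * of_int j\<bar>" using 1 by simp
    qed (use \<open>p > 1\<close> in auto)
    have q: "integrable (count_space (- {0::int})) (\<lambda>j. max 1 \<bar>of_int j\<bar> powr - p)"
      using integrable_int_powr[OF \<open>p > 1\<close>] abs_summable_on_subset[of _ UNIV "- {0::int}"]
      by (auto simp: Infinite_Set_Sum.abs_summable_on_def)
    have "(\<integral>j. \<bar>x + 2 * pi * of_int j\<bar> powr - p \<partial>count_space (- {0::int}))
        \<le> (\<integral>j. max 1 \<bar>of_int j\<bar> powr - p \<partial>count_space (- {0::int}))"
      by (rule integral_mono[OF integrable_lattice_shift[OF \<open>p > 1\<close>] q]) (use x le in auto)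
    also have "\<dots> \<le> Z"
      using integral_count_space_remove[OF integrable_int_powr[OF \<open>p > 1\<close>], of 0] by (simp add: Z_def)
    finally show "(\<integral>j. \<bar>x + 2 * pi * of_int j\<bar> powr - p \<partial>count_space (- {0::int})) \<le> Z * 1" by simp
  qed auto
  moreover have "symbol_on ?V lattice_dist n (\<lambda>x. lattice_dist x powr p) (\<lambda>x. 1 / periodization g x)"
    by (rule symbol_on_mono[OF inv, where K = 1]) (use lattice_dist_pos in auto)
  ultimately have "symbol_on ?V lattice_dist n (\<lambda>x. 1 * lattice_dist x powr p) (\<lambda>x. S x * (1 / periodization g x))"
    by (rule symbol_on_mult) (use lattice_dist_pos in auto)
  then have "symbol_on ?V lattice_dist n (\<lambda>x. 1 * lattice_dist x powr p) (\<lambda>x. 1 - g x / periodization g x)"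
  proof (rule symbol_on_cong)
    show "open ?V" using open_off_lattice by auto
    fix x assume "x \<in> ?V"
    then show "S x * (1 / periodization g x) = 1 - g x / periodization g x"
      using rem[of x 0] P0[of x] by (auto simp: S_def field_simps)
  qed
  then show ?near by simp
qed

subsection \<open>Decay of the Fourier integral\<close>

text \<open>The function G(t) = f(t) exp(i x t) vanishes at infinity, so its integrable derivative
  has integral 0. Continuity of \<open>f\<close> across the locally finite set \<open>S\<close> lets
  the fundamental theorem of calculus ignore the exceptional points.\<close>

lemma fourier_integration_by_parts:
  fixes f f' :: "real \<Rightarrow> real" and p x :: real
  assumes cont: "continuous_on UNIV f" and fin: "\<And>R. finite (S \<inter> {-R..R})"
    and der: "\<And>t. t \<notin> S \<Longrightarrow> (f has_real_derivative f' t) (at t)"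
    and meas: "f' \<in> borel_measurable borel" and "p > 1"
    and bd: "\<And>t. \<bar>f t\<bar> \<le> C * max 1 \<bar>t\<bar> powr - p" "\<And>t. \<bar>f' t\<bar> \<le> C' * max 1 \<bar>t\<bar> powr - p"
  shows "(CLBINT t. of_real (f' t) * exp (\<i> * of_real x * of_real t)) =
    - (\<i> * of_real x) * (CLBINT t. of_real (f t) * exp (\<i> * of_real x * of_real t))"
proof -
  define e where "e t = exp (\<i> * of_real x * of_real t)" for t :: real
  have e1: "norm (e t) = 1" for t by (simp add: e_def norm_exp_eq_Re)
  have e_cont: "continuous_on A e" for A unfolding e_def by (intro continuous_intros)
  have [measurable]: "e \<in> borel_measurable borel" "f \<in> borel_measurable borel" "f' \<in> borel_measurable borel"
    using e_cont cont meas by (auto intro: borel_measurable_continuous_onI)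
  have int: "integrable lborel (\<lambda>t. of_real (h t) * e t)"
    if [measurable]: "h \<in> borel_measurable borel" and h: "\<And>t. \<bar>h t\<bar> \<le> K * max 1 \<bar>t\<bar> powr - p"
    for h :: "real \<Rightarrow> real" and K
  proof (rule Bochner_Integration.integrable_bound)
    show "integrable lborel (\<lambda>t. K * max 1 \<bar>t\<bar> powr - p)"
      by (intro integrable_mult_right integrable_max_powr \<open>p > 1\<close>)
    show "AE t in lborel. norm (of_real (h t) * e t) \<le> norm (K * max 1 \<bar>t\<bar> powr - p)"
      using h order_trans[OF h abs_ge_self] by (auto simp: norm_mult e1)
  qed auto
  define G where "G t = of_real (f t) * e t" for t
  define G' where "G' t = of_real (f' t) * e t + (\<i> * of_real x) * (of_real (f t) * e t)" for t
  have intf: "integrable lborel (\<lambda>t. of_real (f t) * e t)" by (rule int[OF _ bd(1)]) auto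
  have intf': "integrable lborel (\<lambda>t. of_real (f' t) * e t)" by (rule int[OF _ bd(2)]) auto
  have intG': "integrable lborel G'"
    unfolding G'_def by (intro Bochner_Integration.integrable_add integrable_mult_right intf intf')
  have FTC: "(LINT t:{-R..R}|lborel. G' t) = G R - G (- R)" if "R \<ge> 0" for R
  proof -
    have "(G' has_integral (G R - G (- R))) {-R..R}"
    proof (rule fundamental_theorem_of_calculus_strong[OF fin])
      show "continuous_on {-R..R} G"
        unfolding G_def using cont e_cont
        by (intro continuous_intros) (auto intro: continuous_on_subset)
      fix t assume "t \<in> {-R..R} - S \<inter> {-R..R}"
      then have "(f has_real_derivative f' t) (at t)" by (intro der) auto
      then have "((\<lambda>t. complex_of_real (f t)) has_vector_derivative of_real (f' t)) (at t)"
        by (intro has_vector_derivative_of_real) (simp add: has_real_derivative_iff_has_vector_derivative)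
      moreover have "(e has_vector_derivative (\<i> * of_real x) * e t) (at t)"
      proof -
        have "((\<lambda>z. exp (\<i> * of_real x * z)) has_field_derivative (\<i> * of_real x) * e t) (at (of_real t))"
          unfolding e_def by (auto intro!: derivative_eq_intros)
        from has_vector_derivative_real_field[OF this] show ?thesis
          by (simp add: e_def[abs_def])
      qed
      ultimately have "((\<lambda>t. of_real (f t) * e t) has_vector_derivative
          (of_real (f t) * ((\<i> * of_real x) * e t) + of_real (f' t) * e t)) (at t)"
        by (rule has_vector_derivative_mult)
      then show "(G has_vector_derivative G' t) (at t)"
        by (simp add: G_def[abs_def] G'_def algebra_simps)
    qed (use that in auto)
    moreover have "set_integrable lborel {-R..R} G'"
      unfolding set_integrable_def by (intro integrable_mult_indicator intG') auto
    ultimately show ?thesis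
      by (simp add: set_borel_integral_eq_integral integral_unique)
  qed
  \<comment> \<open>Stated for any sequence of unbounded modulus, so that both end points n and -n
    are covered.\<close>
  have dec: "((\<lambda>n. max 1 \<bar>r n\<bar> powr - p) \<longlonglongrightarrow> 0)" if "filterlim (\<lambda>n. \<bar>r n\<bar>) at_top sequentially" for r :: "nat \<Rightarrow> real"
  proof -
    have "filterlim (\<lambda>n. max 1 \<bar>r n\<bar>) at_top sequentially"
      by (rule filterlim_at_top_mono[OF that]) auto
    then show ?thesis using \<open>p > 1\<close> by (intro tendsto_neg_powr) auto
  qed
  have G0: "(\<lambda>n. G (r n)) \<longlonglongrightarrow> 0" if "filterlim (\<lambda>n. \<bar>r n\<bar>) at_top sequentially" for r :: "nat \<Rightarrow> real"
  proof (rule Lim_null_comparison)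
    show "eventually (\<lambda>n. norm (G (r n)) \<le> C * max 1 \<bar>r n\<bar> powr - p) sequentially"
      using bd(1) by (auto simp: G_def norm_mult e1)
    show "(\<lambda>n. C * max 1 \<bar>r n\<bar> powr - p) \<longlonglongrightarrow> 0"
      using tendsto_mult_right_zero[OF dec[OF that]] by simp
  qed
  have "(\<lambda>n. LINT t:{- real n..real n}|lborel. G' t) \<longlonglongrightarrow> (LINT t|lborel. G' t)"
    unfolding set_lebesgue_integral_def
  proof (rule integral_dominated_convergence)
    show "integrable lborel (\<lambda>t. norm (G' t))" using intG' by auto
    show "AE t in lborel. (\<lambda>n. indicat_real {- real n..real n} t *\<^sub>R G' t) \<longlonglongrightarrow> G' t"
    proof (rule AE_I2)
      fix t :: real
      have "eventually (\<lambda>n. real n \<ge> \<bar>t\<bar>) sequentially"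
        using filterlim_real_sequentially by (simp add: filterlim_at_top)
      then have "eventually (\<lambda>n. G' t = indicat_real {- real n..real n} t *\<^sub>R G' t) sequentially"
        by eventually_elim (auto simp: indicator_def)
      then show "(\<lambda>n. indicat_real {- real n..real n} t *\<^sub>R G' t) \<longlonglongrightarrow> G' t"
        by (rule Lim_transform_eventually[OF tendsto_const])
    qed
    show "(\<lambda>t. indicat_real {- real n..real n} t *\<^sub>R G' t) \<in> borel_measurable lborel" for n
      using intG' by (intro borel_measurable_scaleR) auto
  qed (use intG' in \<open>auto simp: indicator_def\<close>)
  moreover have "(\<lambda>n. LINT t:{- real n..real n}|lborel. G' t) \<longlonglongrightarrow> 0 - 0"
    unfolding FTC[OF of_nat_0_le_iff]
    by (intro tendsto_diff G0) (simp_all add: filterlim_real_sequentially)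
  ultimately have "(LINT t|lborel. G' t) = 0"
    using LIMSEQ_unique by fastforce
  moreover have "(LINT t|lborel. G' t) = (CLBINT t. of_real (f' t) * e t) + (\<i> * of_real x) * (CLBINT t. of_real (f t) * e t)"
    unfolding G'_def using intf intf' by (subst Bochner_Integration.integral_add) auto
  ultimately show ?thesis unfolding e_def by (simp add: add_eq_0_iff2)
qed

text \<open>Each integration by parts yields a factor -i x, so |x|^N times the transform of
  \<open>E 0\<close> is bounded by the L1 norm of \<open>E N\<close>. The last function only has to
  be measurable and dominated, not continuous.\<close>

lemma fourier_decay:
  fixes E :: "nat \<Rightarrow> real \<Rightarrow> real" and p :: real
  assumes cont: "\<And>i. i < N \<Longrightarrow> continuous_on UNIV (E i)" and fin: "\<And>R. finite (S \<inter> {-R..R})"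
    and der: "\<And>i t. i < N \<Longrightarrow> t \<notin> S \<Longrightarrow> (E i has_real_derivative E (Suc i) t) (at t)"
    and meas: "\<And>i. i \<le> N \<Longrightarrow> E i \<in> borel_measurable borel" and "p > 1"
    and bd: "\<And>i. i \<le> N \<Longrightarrow> \<exists>C. \<forall>t. \<bar>E i t\<bar> \<le> C * max 1 \<bar>t\<bar> powr - p"
  shows "\<exists>K. \<forall>x. \<bar>x\<bar> ^ N * norm (CLBINT t. of_real (E 0 t) * exp (\<i> * of_real x * of_real t)) \<le> K"
proof -
  define I where "I i x = (CLBINT t. of_real (E i t) * exp (\<i> * of_real x * of_real t))" for i and x :: real
  have step: "I i x = (- (\<i> * of_real x)) ^ i * I 0 x" if "i \<le> N" for i x
    using that
  proof (induction i)
    case (Suc i)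
    obtain C C' where "\<forall>t. \<bar>E i t\<bar> \<le> C * max 1 \<bar>t\<bar> powr - p" "\<forall>t. \<bar>E (Suc i) t\<bar> \<le> C' * max 1 \<bar>t\<bar> powr - p"
      using bd[of i] bd[of "Suc i"] Suc.prems by auto
    then have "I (Suc i) x = - (\<i> * of_real x) * I i x"
      unfolding I_def using Suc.prems
      by (intro fourier_integration_by_parts[OF cont fin der meas \<open>p > 1\<close>]) auto
    then show ?case using Suc by simp
  qed simp
  obtain C where C: "\<And>t. \<bar>E N t\<bar> \<le> C * max 1 \<bar>t\<bar> powr - p" using bd[of N] by auto
  define K where "K = (\<integral>t. \<bar>E N t\<bar> \<partial>lborel)"
  have "\<bar>x\<bar> ^ N * norm (I 0 x) \<le> K" for x
  proof -
    have "\<bar>x\<bar> ^ N * norm (I 0 x) = norm (I N x)"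
      by (simp add: step[OF order_refl] norm_mult norm_power)
    also have "\<dots> \<le> (\<integral>t. norm (of_real (E N t) * exp (\<i> * of_real x * of_real t)) \<partial>lborel)"
      unfolding I_def by (rule integral_norm_bound)
    also have "\<dots> = K" by (simp add: norm_mult norm_exp_eq_Re K_def)
    finally show ?thesis .
  qed
  then show ?thesis unfolding I_def by blast
qed

section \<open>Extension of the quotient across the lattice\<close>

lemma finite_lattice_Icc: "finite ((- off_lattice) \<inter> {-R..R})"
proof (rule finite_subset)
  show "- off_lattice \<inter> {-R..R} \<subseteq> (\<lambda>k. 2 * pi * of_int k) ` {\<lfloor>- R / (2 * pi)\<rfloor>..\<lceil>R / (2 * pi)\<rceil>}"
  proof
    fix x assume x: "x \<in> - off_lattice \<inter> {-R..R}"
    then obtain k :: int where k: "x / (2 * pi) = of_int k"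
      by (auto simp: off_lattice_def elim: Ints_cases)
    have "- R / (2 * pi) \<le> x / (2 * pi)" "x / (2 * pi) \<le> R / (2 * pi)"
      by (intro divide_right_mono; use x in simp)+
    then have "k \<in> {\<lfloor>- R / (2 * pi)\<rfloor>..\<lceil>R / (2 * pi)\<rceil>}"
      unfolding k by (auto simp: floor_le_iff le_ceiling_iff)
    moreover have "x = 2 * pi * of_int k" using k by (simp add: field_simps)
    ultimately show "x \<in> (\<lambda>k. 2 * pi * of_int k) ` {\<lfloor>- R / (2 * pi)\<rfloor>..\<lceil>R / (2 * pi)\<rceil>}" by blast
  qed
qed auto

text \<open>Distinct lattice points are at least 2 pi apart; 1 is a convenient smaller
  radius.\<close>

lemma lattice_isolated:
  assumes "x \<notin> off_lattice" "y \<noteq> x" "\<bar>y - x\<bar> \<le> 1"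
  shows "y \<in> off_lattice"
proof (rule ccontr)
  assume "y \<notin> off_lattice"
  then obtain m where m: "y / (2 * pi) = of_int m" by (auto simp: off_lattice_def elim: Ints_cases)
  obtain k where k: "x / (2 * pi) = of_int k" using assms(1) by (auto simp: off_lattice_def elim: Ints_cases)
  have "y - x = 2 * pi * of_int (m - k)" using m k by (simp add: field_simps)
  moreover from this have "m - k \<noteq> 0" using assms(2) by auto
  then have "1 \<le> \<bar>of_int (m - k) :: real\<bar>" by linarith
  then have "2 * pi * 1 \<le> 2 * pi * \<bar>of_int (m - k)\<bar>" by (intro mult_left_mono) auto
  ultimately have "2 * pi \<le> \<bar>y - x\<bar>" by (simp only: abs_mult) simp
  then show False using assms(3) pi_gt3 by simp
qed

lemma lattice_dist_le_lattice_point: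
  assumes "x \<notin> off_lattice"
  shows "lattice_dist y \<le> \<bar>y - x\<bar>"
proof -
  obtain k where k: "x / (2 * pi) = of_int k" using assms(1) by (auto simp: off_lattice_def elim: Ints_cases)
  then have "x = 2 * pi * of_int k" by (simp add: field_simps)
  then show ?thesis using lattice_dist_le[of y "- k"] by simp
qed

text \<open>Symbol bounds of order \<open>Suc N\<close> make even the N-th derivative
  differentiable, hence continuous, off the lattice; that gives its measurability.\<close>

lemma quotient_extension:
  fixes p :: real and Q :: "real \<Rightarrow> real"
  assumes far: "symbol_on off_lattice lattice_dist (Suc N) (\<lambda>x. \<bar>x\<bar> powr - p * lattice_dist x powr p) Q"
    and near: "symbol_on (off_lattice \<inter> {-pi<..<pi}) lattice_dist (Suc N) (\<lambda>x. lattice_dist x powr p) (\<lambda>x. 1 - Q x)"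
    and p: "real N \<le> p" "p > 1"
  obtains E :: "nat \<Rightarrow> real \<Rightarrow> real"
  where "\<And>x. x \<in> off_lattice \<Longrightarrow> E 0 x = Q x"
    and "\<And>x. x \<notin> off_lattice \<Longrightarrow> (Q \<longlongrightarrow> E 0 x) (at x)"
    and "\<And>i. i < N \<Longrightarrow> continuous_on UNIV (E i)"
    and "\<And>i t. i < N \<Longrightarrow> t \<in> off_lattice \<Longrightarrow> (E i has_real_derivative E (Suc i) t) (at t)"
    and "\<And>i. i \<le> N \<Longrightarrow> E i \<in> borel_measurable borel"
    and "\<And>i. i \<le> N \<Longrightarrow> \<exists>C. \<forall>t. \<bar>E i t\<bar> \<le> C * max 1 \<bar>t\<bar> powr - p"
proof -
  let ?w = lattice_dist
  define V where "V = off_lattice \<inter> {-pi<..<pi}"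
  have "open V" unfolding V_def using open_off_lattice by auto
  obtain F where F: "F 0 = Q"
    "\<And>i x. i < Suc N \<Longrightarrow> x \<in> off_lattice \<Longrightarrow> (F i has_real_derivative F (Suc i) x) (at x)"
    "\<And>i. i \<le> Suc N \<Longrightarrow> \<exists>C\<ge>0. \<forall>x\<in>off_lattice. \<bar>F i x\<bar> \<le> C * (\<bar>x\<bar> powr - p * ?w x powr p / ?w x ^ i)"
    using symbol_on_derivatives[OF far] lattice_dist_pos by auto
  obtain G where G: "G 0 = (\<lambda>x. 1 - Q x)"
    "\<And>i x. i < Suc N \<Longrightarrow> x \<in> V \<Longrightarrow> (G i has_real_derivative G (Suc i) x) (at x)"
    "\<And>i. i \<le> Suc N \<Longrightarrow> \<exists>C\<ge>0. \<forall>x\<in>V. \<bar>G i x\<bar> \<le> C * (?w x powr p / ?w x ^ i)"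
    using symbol_on_derivatives[OF near] lattice_dist_pos unfolding V_def by auto
  \<comment> \<open>The i-th derivative of the constant 1, and the value that the i-th derivative of
    the extended quotient receives at 0.\<close>
  define \<delta> :: "nat \<Rightarrow> real" where "\<delta> i = (if i = 0 then 1 else 0)" for i
  \<comment> \<open>The derivative sequences of \<open>Q\<close> and \<open>1 - Q\<close> were
    obtained separately; uniqueness of derivatives matches them on \<open>V\<close>.\<close>
  have GF: "G i x = \<delta> i - F i x" if "i \<le> Suc N" "x \<in> V" for i x
    using that
  proof (induction i arbitrary: x)
    case 0
    then show ?case by (simp add: F G \<delta>_def)
  next
    case (Suc i)
    have "((\<lambda>x. \<delta> i - F i x) has_real_derivative - F (Suc i) x) (at x)"
      using F(2)[of i x] Suc.prems by (auto intro!: derivative_eq_intros simp: V_def)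
    then have "(G i has_real_derivative - F (Suc i) x) (at x)"
      by (rule has_field_derivative_transform_within_open[OF _ \<open>open V\<close>]) (use Suc in auto)
    then show ?case using DERIV_unique[OF G(2)[of i x]] Suc.prems by (simp add: \<delta>_def)
  qed
  have pow: "?w x powr p / ?w x ^ i = ?w x powr (p - real i)" if "x \<in> off_lattice" for x i
    using lattice_dist_pos[OF that] by (simp add: powr_diff powr_realpow)
  have nearF: "\<exists>C\<ge>0. \<forall>x\<in>V. \<bar>F i x - \<delta> i\<bar> \<le> C * ?w x powr (p - real i)" if i: "i \<le> N" for i
  proof -
    obtain C where C: "C \<ge> 0" "\<forall>x\<in>V. \<bar>G i x\<bar> \<le> C * (?w x powr p / ?w x ^ i)" using G(3)[of i] i by auto
    have "\<bar>F i x - \<delta> i\<bar> \<le> C * ?w x powr (p - real i)" if "x \<in> V" for x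
    proof -
      have "\<bar>F i x - \<delta> i\<bar> = \<bar>G i x\<bar>" using GF[of i x] i that by (simp add: abs_minus_commute)
      also have "\<dots> \<le> C * (?w x powr p / ?w x ^ i)" using C(2) that by blast
      also have "?w x powr p / ?w x ^ i = ?w x powr (p - real i)" using that by (intro pow) (simp add: V_def)
      finally show ?thesis .
    qed
    with C(1) show ?thesis by blast
  qed
  have farF: "\<exists>C\<ge>0. \<forall>x\<in>off_lattice. \<bar>F i x\<bar> \<le> C * (\<bar>x\<bar> powr - p * ?w x powr (p - real i))" if i: "i \<le> N" for i
  proof -
    obtain C where C: "C \<ge> 0" "\<forall>x\<in>off_lattice. \<bar>F i x\<bar> \<le> C * (\<bar>x\<bar> powr - p * ?w x powr p / ?w x ^ i)"
      using F(3)[of i] i by auto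
    have "\<bar>F i x\<bar> \<le> C * (\<bar>x\<bar> powr - p * ?w x powr (p - real i))" if "x \<in> off_lattice" for x
      using C(2) that pow[of x i] by (metis times_divide_eq_right)
    with C(1) show ?thesis by blast
  qed
  \<comment> \<open>For i < p the values on the lattice are the limits there: \<open>Q\<close> tends
    to 1 at 0 and to 0 at the other lattice points, its derivatives to 0. If i = N = p, they are
    mere default values.\<close>
  define E where "E i x = (if x \<in> off_lattice then F i x else if x = 0 then \<delta> i else 0)" for i x
  have Econg: "eventually (\<lambda>y. F i y = E i y) (nhds x)" if "x \<in> off_lattice" for i x
    using eventually_nhds_in_open[OF open_off_lattice that] by eventually_elim (simp add: E_def)
  have near_lattice: "eventually (\<lambda>y. y \<in> off_lattice \<and> \<bar>y - x\<bar> < 1) (at x)" if "x \<notin> off_lattice" for x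
    unfolding eventually_at using lattice_isolated[OF that]
    by (intro exI[of _ 1]) (auto simp: dist_real_def)
  \<comment> \<open>As p - i is positive, the distance to that power tends to 0. The near estimate
    is used at 0, the far estimate at the other lattice points, where |y| \<ge> 1 bounds the factor
    \<open>\<bar>y\<bar> powr - p\<close> by 1.\<close>
  have lim: "(E i \<longlongrightarrow> E i x) (at x)" if i: "i \<le> N" "real i < p" and x: "x \<notin> off_lattice" for i x
  proof -
    obtain C where C: "C \<ge> 0" "\<And>y. y \<in> V \<Longrightarrow> \<bar>F i y - \<delta> i\<bar> \<le> C * ?w y powr (p - real i)"
      using nearF[OF i(1)] by auto
    obtain D where D: "D \<ge> 0" "\<And>y. y \<in> off_lattice \<Longrightarrow> \<bar>F i y\<bar> \<le> D * (\<bar>y\<bar> powr - p * ?w y powr (p - real i))"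
      using farF[OF i(1)] by auto
    have "((\<lambda>y. E i y - E i x) \<longlongrightarrow> 0) (at x)"
    proof (rule Lim_null_comparison)
      show "eventually (\<lambda>y. norm (E i y - E i x) \<le> (C + D) * \<bar>y - x\<bar> powr (p - real i)) (at x)"
        using near_lattice[OF x]
      proof eventually_elim
        case (elim y)
        have w: "?w y powr (p - real i) \<le> \<bar>y - x\<bar> powr (p - real i)"
          using lattice_dist_le_lattice_point[OF x, of y] lattice_dist_pos[of y] elim i
          by (intro powr_mono2) auto
        show ?case
        proof (cases "x = 0")
          case True
          then have "y \<in> V" using elim pi_gt3 by (auto simp: V_def)
          then have "\<bar>F i y - \<delta> i\<bar> \<le> C * \<bar>y - x\<bar> powr (p - real i)"
            using C(2) w C(1) by (meson mult_left_mono order_trans)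
          also have "\<dots> \<le> (C + D) * \<bar>y - x\<bar> powr (p - real i)"
            using D(1) by (intro mult_right_mono) auto
          finally show ?thesis using elim True x by (simp add: E_def)
        next
          case False
          obtain k :: int where "x / (2 * pi) = of_int k" using x by (auto simp: off_lattice_def elim: Ints_cases)
          then have k: "x = 2 * pi * of_int k" by (simp add: field_simps)
          then have "k \<noteq> 0" using False by auto
          then have "1 \<le> \<bar>of_int k :: real\<bar>" by linarith
          then have "2 * pi * 1 \<le> 2 * pi * \<bar>of_int k\<bar>" by (intro mult_left_mono) auto
          also have "\<dots> = \<bar>x\<bar>" using k by (simp add: abs_mult)
          finally have "\<bar>x\<bar> \<ge> 2" using pi_gt3 by linarith
          then have "\<bar>y\<bar> \<ge> 1" using elim by linarith
          then have y: "\<bar>y\<bar> powr - p \<le> 1" using powr_mono2'[of "- p" 1 "\<bar>y\<bar>"] p by simp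
          have "\<bar>F i y\<bar> \<le> D * (\<bar>y\<bar> powr - p * ?w y powr (p - real i))" using D elim by blast
          also have "\<dots> \<le> D * (1 * \<bar>y - x\<bar> powr (p - real i))"
            using D(1) y w by (intro mult_left_mono mult_mono) auto
          also have "\<dots> \<le> (C + D) * \<bar>y - x\<bar> powr (p - real i)"
            unfolding mult_1 using C(1) by (intro mult_right_mono) auto
          finally show ?thesis using elim False x by (simp add: E_def)
        qed
      qed
      have "((\<lambda>y. \<bar>y - x\<bar>) \<longlongrightarrow> \<bar>x - x\<bar>) (at x)" by (intro tendsto_intros)
      then have "((\<lambda>y. \<bar>y - x\<bar> powr (p - real i)) \<longlongrightarrow> 0) (at x)"
        using i by (intro tendsto_zero_powrI[OF _ tendsto_const]) auto
      then show "((\<lambda>y. (C + D) * \<bar>y - x\<bar> powr (p - real i)) \<longlongrightarrow> 0) (at x)"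
        by (rule tendsto_mult_right_zero)
    qed
    then show ?thesis by (simp add: LIM_zero_iff)
  qed
  have derE: "(E i has_real_derivative E (Suc i) t) (at t)" if "i \<le> N" "t \<in> off_lattice" for i t
  proof -
    have "(F i has_real_derivative F (Suc i) t) (at t)" using F(2) that by simp
    then have "(E i has_real_derivative F (Suc i) t) (at t)"
      by (rule has_field_derivative_transform_within_open[OF _ open_off_lattice that(2)]) (simp add: E_def)
    then show ?thesis using that by (simp add: E_def)
  qed
  have "continuous_on UNIV (E i)" if "i < N" for i
    unfolding continuous_on_eq_continuous_at[OF open_UNIV]
  proof
    fix x
    show "isCont (E i) x"
    proof (cases "x \<in> off_lattice")
      case True
      then show ?thesis using derE[of i x] that by (auto intro: DERIV_isCont)
    next
      case False
      then show ?thesis using lim[of i x] that p by (auto simp: isCont_def)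
    qed
  qed
  moreover have "E i \<in> borel_measurable borel" if "i \<le> N" for i
  proof (rule borel_measurable_continuous_countable_exceptions)
    show "continuous_on (- (- off_lattice)) (E i)"
      using derE[OF that] by (auto intro!: continuous_at_imp_continuous_on DERIV_isCont)
    show "countable (- off_lattice)"
    proof (rule countable_subset)
      show "- off_lattice \<subseteq> range (\<lambda>k::int. 2 * pi * of_int k)"
      proof
        fix x assume "x \<in> - off_lattice"
        then obtain k :: int where "x / (2 * pi) = of_int k" by (auto simp: off_lattice_def elim: Ints_cases)
        then have "x = 2 * pi * of_int k" by (simp add: field_simps)
        then show "x \<in> range (\<lambda>k::int. 2 * pi * of_int k)" by blast
      qed
    qed auto
  qed
  moreover have "\<exists>C. \<forall>t. \<bar>E i t\<bar> \<le> C * max 1 \<bar>t\<bar> powr - p" if i: "i \<le> N" for i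
  proof -
    obtain C where C: "C \<ge> 0" "\<And>y. y \<in> V \<Longrightarrow> \<bar>F i y - \<delta> i\<bar> \<le> C * ?w y powr (p - real i)"
      using nearF[OF i] by auto
    obtain D where D: "D \<ge> 0" "\<And>y. y \<in> off_lattice \<Longrightarrow> \<bar>F i y\<bar> \<le> D * (\<bar>y\<bar> powr - p * ?w y powr (p - real i))"
      using farF[OF i] by auto
    define W where "W = pi powr (p - real i)"
    have W: "W \<ge> 0" by (simp add: W_def)
    have w: "?w y powr (p - real i) \<le> W" if "y \<in> off_lattice" for y
      unfolding W_def using lattice_dist_pos[OF that] lattice_dist_le_pi[of y] i p
      by (intro powr_mono2) auto
    \<comment> \<open>On |t| < pi the target weight is at least \<open>pi powr - p\<close>; the
      factor \<open>pi powr p\<close> compensates for it.\<close>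
    define B where "B = (1 + C * W) * pi powr p"
    have B: "B \<ge> 0" using C(1) W by (simp add: B_def)
    have "\<bar>E i t\<bar> \<le> (1 + B + D * W) * max 1 \<bar>t\<bar> powr - p" for t
    proof -
      consider (lattice) "t \<notin> off_lattice" | (near) "t \<in> V" | (far) "t \<in> off_lattice" "\<bar>t\<bar> \<ge> pi"
        by (cases "t \<in> off_lattice"; cases "\<bar>t\<bar> < pi") (auto simp: V_def abs_less_iff)
      then show ?thesis
      proof cases
        case lattice
        have "\<bar>E i t\<bar> \<le> 1 * max 1 \<bar>t\<bar> powr - p" using lattice by (auto simp: E_def \<delta>_def)
        also have "\<dots> \<le> (1 + B + D * W) * max 1 \<bar>t\<bar> powr - p"
          using B D(1) W by (intro mult_right_mono) auto
        finally show ?thesis .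
      next
        case near
        then have t: "t \<in> off_lattice" "\<bar>t\<bar> < pi" by (auto simp: V_def)
        have "\<bar>F i t - \<delta> i\<bar> \<le> C * W"
          using C(2)[OF near] mult_left_mono[OF w[OF t(1)] C(1)] by linarith
        moreover have "\<bar>\<delta> i\<bar> \<le> 1" by (simp add: \<delta>_def)
        ultimately have "\<bar>E i t\<bar> \<le> 1 + C * W" using t by (simp add: E_def)
        also have "\<dots> = B * pi powr - p" by (simp add: B_def powr_minus_divide)
        also have "\<dots> \<le> B * max 1 \<bar>t\<bar> powr - p"
          using t pi_gt3 p B by (intro mult_left_mono powr_mono2') auto
        also have "\<dots> \<le> (1 + B + D * W) * max 1 \<bar>t\<bar> powr - p"
          using B D(1) W by (intro mult_right_mono) auto
        finally show ?thesis .
      next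
        case far
        have "\<bar>E i t\<bar> \<le> D * (\<bar>t\<bar> powr - p * ?w t powr (p - real i))" using D far by (simp add: E_def)
        also have "\<dots> \<le> D * (\<bar>t\<bar> powr - p * W)"
          using D(1) w[OF far(1)] by (intro mult_left_mono) auto
        also have "\<dots> = (D * W) * max 1 \<bar>t\<bar> powr - p" using far pi_gt3 by (simp add: max_def)
        also have "\<dots> \<le> (1 + B + D * W) * max 1 \<bar>t\<bar> powr - p"
          using B D(1) W by (intro mult_right_mono) auto
        finally show ?thesis .
      qed
    qed
    then show ?thesis by blast
  qed
  moreover have "(Q \<longlongrightarrow> E 0 x) (at x)" if "x \<notin> off_lattice" for x
  proof (rule Lim_transform_eventually)
    show "(E 0 \<longlongrightarrow> E 0 x) (at x)" using lim[of 0 x] that p by simp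
    show "eventually (\<lambda>y. E 0 y = Q y) (at x)"
      using near_lattice[OF that] by eventually_elim (simp add: E_def F)
  qed
  moreover have "\<forall>x\<in>off_lattice. E 0 x = Q x" by (simp add: E_def F)
  ultimately show thesis using derE by (intro that[of E]) auto
qed

section \<open>Decay of the fundamental function\<close>

lemma multiquadric_hat_eq:
  assumes "c > 0"
  shows "multiquadric_hat \<alpha> c x =
    2 powr (1 + \<alpha>) / Gamma (- \<alpha>) * c powr (\<alpha> + 1 / 2) * radial_hat (\<alpha> + 1 / 2) c x"
  using assms powr_minus_divide[of "\<bar>x\<bar>" "\<alpha> + 1 / 2"]
  by (simp add: multiquadric_hat_def radial_hat_def powr_divide)

lemma fundamental_quotient_eq:
  assumes "\<alpha> > 0" "\<alpha> \<notin> \<nat>" "c > 0" "x \<in> off_lattice"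
  shows "fundamental_quotient \<alpha> c x =
    radial_hat (\<alpha> + 1 / 2) c x / periodization (radial_hat (\<alpha> + 1 / 2) c) x"
proof -
  define A where "A = 2 powr (1 + \<alpha>) / Gamma (- \<alpha>) * c powr (\<alpha> + 1 / 2)"
  let ?g = "radial_hat (\<alpha> + 1 / 2) c"
  \<comment> \<open>\<open>Gamma\<close> takes the value 0 exactly at the nonpositive integers, so
    the common factor \<open>A\<close> is nonzero and cancels.\<close>
  have "- \<alpha> \<notin> \<int>\<^sub>\<le>\<^sub>0" using assms(2) by (auto elim!: nonpos_Ints_cases')
  then have A: "A \<noteq> 0" using assms by (simp add: A_def Gamma_eq_zero_iff)
  have "symbol_on (- {0}) abs 0 (\<lambda>x. \<bar>x\<bar> powr - (2 * (\<alpha> + 1 / 2))) ?g"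
    using symbol_on_radial_hat[of c "\<alpha> + 1 / 2" 0] assms by (simp only: mult_minus_left)
  then have "integrable (count_space UNIV) (\<lambda>j::int. ?g (x + 2 * pi * of_int j))"
    by (rule integrable_periodization) (use assms in auto)
  then have "periodization ?g x = (\<Sum>\<^sub>\<infinity>j::int. ?g (x + 2 * pi * of_int j))"
    using infsetsum_infsum[of "\<lambda>j::int. ?g (x + 2 * pi * of_int j)" UNIV]
    by (simp add: periodization_def infsetsum_def Infinite_Set_Sum.abs_summable_on_def)
  moreover have "(\<Sum>\<^sub>\<infinity>j::int. A * ?g (x + 2 * pi * of_int j)) = A * (\<Sum>\<^sub>\<infinity>j::int. ?g (x + 2 * pi * of_int j))"
    by (rule infsum_cmult_right')
  ultimately show ?thesis
    using A unfolding fundamental_quotient_def multiquadric_hat_eq[OF assms(3)] A_def[symmetric] by simp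
qed

theorem corollary11:
  fixes \<alpha> c :: real
  assumes "\<alpha> > 0" and "\<alpha> \<notin> \<nat>" and "c \<ge> 1"
  shows "fundamental_function \<alpha> c
           \<in> O[at_infinity](\<lambda>x. complex_of_real (\<bar>x\<bar> powi (- \<lfloor>2 * \<alpha> + 1\<rfloor>)))"
proof -
  define \<nu> where "\<nu> = \<alpha> + 1 / 2"
  define p where "p = 2 * \<nu>"
  define N where "N = nat \<lfloor>p\<rfloor>"
  have p: "p > 1" "p = 2 * \<alpha> + 1" using assms(1) by (auto simp: p_def \<nu>_def)
  have N: "\<lfloor>2 * \<alpha> + 1\<rfloor> = int N" "real N \<le> p" using p by (auto simp: N_def)
  have c: "c > 0" and \<nu>: "\<nu> > 0" using assms by (auto simp: \<nu>_def)
  define Q where "Q x = radial_hat \<nu> c x / periodization (radial_hat \<nu> c) x" for x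
  have g: "symbol_on (- {0}) abs n (\<lambda>x. \<bar>x\<bar> powr - p) (radial_hat \<nu> c)" for n
    using symbol_on_radial_hat[OF c \<nu>] by (simp add: p_def)
  obtain b where b: "b > 0" "\<And>x. x \<noteq> 0 \<Longrightarrow> \<bar>x\<bar> \<le> pi \<Longrightarrow> b * \<bar>x\<bar> powr - p \<le> radial_hat \<nu> c x"
    using radial_hat_lower[OF c \<nu> pi_gt_zero] by (auto simp: p_def)
  have symbols: "symbol_on off_lattice lattice_dist (Suc N) (\<lambda>x. \<bar>x\<bar> powr - p * lattice_dist x powr p) Q"
    "symbol_on (off_lattice \<inter> {-pi<..<pi}) lattice_dist (Suc N) (\<lambda>x. lattice_dist x powr p) (\<lambda>x. 1 - Q x)"
    unfolding Q_def by (rule symbol_on_quotient[OF g p(1) radial_hat_nonneg b(1)]; fact b(2))+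
  obtain E where E: "\<And>x. x \<in> off_lattice \<Longrightarrow> E 0 x = Q x"
      "\<And>x. x \<notin> off_lattice \<Longrightarrow> (Q \<longlongrightarrow> E 0 x) (at x)"
      "\<And>i. i < N \<Longrightarrow> continuous_on UNIV (E i)"
      "\<And>i t. i < N \<Longrightarrow> t \<in> off_lattice \<Longrightarrow> (E i has_real_derivative E (Suc i) t) (at t)"
      "\<And>i. i \<le> N \<Longrightarrow> E i \<in> borel_measurable borel"
      "\<And>i. i \<le> N \<Longrightarrow> \<exists>C. \<forall>t. \<bar>E i t\<bar> \<le> C * max 1 \<bar>t\<bar> powr - p"
  proof (rule quotient_extension[OF symbols N(2) p(1)], goal_cases)
    case (1 E)
    show ?case by (rule 1(1)[of E]) (simp_all add: 1(2-7))
  qed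
  have quot: "fundamental_quotient \<alpha> c x = Q x" if "x \<in> off_lattice" for x
    using fundamental_quotient_eq[OF assms(1,2) c that] by (simp add: Q_def \<nu>_def)
  have hat: "fundamental_hat \<alpha> c x = E 0 x" for x
  proof (cases "x \<in> off_lattice")
    case True
    then show ?thesis using quot[OF True] E(1)[OF True] by (simp add: fundamental_hat_def off_lattice_def)
  next
    case False
    \<comment> \<open>No other lattice point lies within distance 1, so the formula for the quotient
      holds on a punctured neighbourhood and the \<open>Lim\<close> in
      \<open>fundamental_hat\<close> is the limit of \<open>Q\<close>.\<close>
    have "eventually (\<lambda>y. Q y = fundamental_quotient \<alpha> c y) (at x)"
      unfolding eventually_at using lattice_isolated[OF False] quot
      by (intro exI[of _ 1]) (auto simp: dist_real_def)
    with E(2)[OF False] have "(fundamental_quotient \<alpha> c \<longlongrightarrow> E 0 x) (at x)"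
      by (rule Lim_transform_eventually)
    then have "Lim (at x) (fundamental_quotient \<alpha> c) = E 0 x" by (intro tendsto_Lim) auto
    then show ?thesis using False by (simp add: fundamental_hat_def off_lattice_def)
  qed
  obtain K where K: "\<And>x. \<bar>x\<bar> ^ N * norm (CLBINT t. of_real (E 0 t) * exp (\<i> * of_real x * of_real t)) \<le> K"
    using fourier_decay[of N E "- off_lattice" p, OF E(3) finite_lattice_Icc E(4) E(5) p(1) E(6)] by auto
  show ?thesis
  \<comment> \<open>The denominator 2 pi comes from the normalisation of the inverse
    transform.\<close>
  proof (rule bigoI[where c = "K / (2 * pi)"])
    have "eventually (\<lambda>x::real. x \<noteq> 0) at_infinity"
      by (auto simp: eventually_at_infinity intro!: exI[of _ 1])
    then show "eventually (\<lambda>x. norm (fundamental_function \<alpha> c x)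
        \<le> K / (2 * pi) * norm (complex_of_real (\<bar>x\<bar> powi (- \<lfloor>2 * \<alpha> + 1\<rfloor>)))) at_infinity"
    proof eventually_elim
      case (elim x)
      have "norm (CLBINT t. of_real (E 0 t) * exp (\<i> * of_real x * of_real t)) \<le> K / \<bar>x\<bar> ^ N"
        using K[of x] elim by (simp add: field_simps)
      then show ?case
        using elim unfolding fundamental_function_def hat N(1)
        by (simp add: norm_mult norm_divide norm_power power_int_minus field_simps)
    qed
  qed
qed

end
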